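(* Let $0<\delta<\pi$ and let $X$ be a w.s.s. random process whose autocorrelation function belongs to $\mathcal{B}_\delta$, so that $$R_X(t,\tau)=\int_{-\delta}^{\delta}e^{i(t-\tau)\xi}\rho(\xi)\,d\xi,\qquad t,\tau\in\mathbb{R},$$ for some nonnegative function $\rho\in L^2([-\delta,\delta])$. Suppose that there exists an interval $[a,b]\subseteq[-\delta,\delta]$ such that $$\rho(\xi)\ge m,\qquad \xi\in[a,b],$$ for some positive constant $m$. Let $\delta':=(b-a)/2$. Then for all $n\in\mathbb{N}$, $$\mathcal{E}_n(R_X)\ge \frac{5\sqrt{2m}}{11e\sqrt{3}}\;\frac{\delta'}{2n+1}\left(\frac{\delta'}{4}\right)^{2n}.$$
   Context: $\mathbb{N}$ denotes the positive integers and $J_n:=\{j\in\mathbb{Z}:-n+1\le j\le n\}$. $\mathcal{B}_\delta$ is the Paley-Wiener space of functions $f\in C(\mathbb{R})\cap L^2(\mathbb{R})$ with Fourier transform supported on $[-\delta,\delta]$. A random process $X=X(t,\omega)$ on a probability space $(\Omega,\mathscr{F},P)$ is w.s.s. (wide sense stationary) if $X(t,\cdot)\in L^2(\Omega,dP)$ for every $t\in\mathbb{R}$ and $R_X(t,\tau):=\int_\Omega X(t,\omega)\overline{X(\tau,\omega)}\,dP(\omega)$ depends only on $t-\tau$; $R_X\in\mathcal{B}_\delta$ means that $t\mapsto R_X(t,0)$ is in $\mathcal{B}_\delta$. As usual, $[a,b]$ denotes a nondegenerate interval, $a<b$. For a positive-definite kernel $K:\mathbb{R}\times\mathbb{R}\to\mathbb{C}$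 (all matrices $[K(t_j,t_k)]$ over finitely many distinct points hermitian positive semi-definite), $\mathcal{H}_K$ denotes the unique reproducing kernel Hilbert space of functions on $\mathbb{R}$ with $K(t,\cdot)\in\mathcal{H}_K$ and $f(t)=\langle f,K(t,\cdot)\rangle_{\mathcal{H}_K}$ for all $f\in\mathcal{H}_K$, $t\in\mathbb{R}$. $R_X(t,\tau)$ is such a kernel. $U(\mathcal{H})$ is the closed unit ball of a Hilbert space $\mathcal{H}$, and $\mathbb{C}^{J_n}$ the set of functions $J_n\to\mathbb{C}$. For a continuous translation-invariant kernel $K$ and a mapping $\mathcal{A}:\mathbb{C}^{J_n}\to L^\infty([0,1])$, put $\mathcal{E}_n(\mathcal{A},K):=\sup\{\|f-\mathcal{A}(f|_{J_n})\|_{L^\infty([0,1])}:f\in U(\mathcal{H}_K)\}$ and $\mathcal{E}_n(K):=\inf_{\mathcal{A}}\mathcal{E}_n(\mathcal{A},K)$, the infimum over all such mappings $\mathcal{A}$. It is known (and may be used as an equivalent definition) that $\mathcal{E}_n(K)=\sup\{\|f\|_{L^\infty([0,1])}:f\in U(\mathcal{H}_K),\ f(j)=0\ \forall j\in J_n\}$. *)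

theory Defs
  imports "HOL-Analysis.Analysis" "HOL-Probability.Probability"
begin

definition square_integrable_on :: "real set \<Rightarrow> (real \<Rightarrow> 'b::{real_normed_vector}) \<Rightarrow> bool" where
  "square_integrable_on S f \<longleftrightarrow>
     f \<in> borel_measurable (lebesgue_on S) \<and>
     integrable (lebesgue_on S) (\<lambda>x. (norm (f x))\<^sup>2)"

(* The Plancherel Fourier transform: g is the L^2-limit of the transforms of the truncations
   of f to [-N, N]. It is a relation because g is determined only almost everywhere. *)
definition has_fourier_transform_L2 :: "(real \<Rightarrow> complex) \<Rightarrow> (real \<Rightarrow> complex) \<Rightarrow> bool" where
  "has_fourier_transform_L2 f g \<longleftrightarrow>
     square_integrable_on UNIV f \<and> square_integrable_on UNIV g \<and>
     ((\<lambda>N::real. \<integral>\<^sup>+ \<xi>. ennreal ((norm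
          (g \<xi> - complex_of_real (1 / sqrt (2 * pi)) *
             (LINT x|lebesgue_on {-N..N}. f x * exp (- (\<i> * complex_of_real (x * \<xi>))))))\<^sup>2)
        \<partial>lebesgue) \<longlongrightarrow> 0) at_top"

definition paley_wiener :: "real \<Rightarrow> (real \<Rightarrow> complex) set" where
  "paley_wiener \<delta> =
     {f. continuous_on UNIV f \<and>
         (\<exists>g. has_fourier_transform_L2 f g \<and> (AE \<xi> in lebesgue. \<xi> \<notin> {-\<delta>..\<delta>} \<longrightarrow> g \<xi> = 0))}"

definition autocorrelation ::
    "'w measure \<Rightarrow> (real \<Rightarrow> 'w \<Rightarrow> complex) \<Rightarrow> real \<Rightarrow> real \<Rightarrow> complex" where
  "autocorrelation M X t \<tau> = (LINT \<omega>|M. X t \<omega> * cnj (X \<tau> \<omega>))"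

definition wide_sense_stationary :: "'w measure \<Rightarrow> (real \<Rightarrow> 'w \<Rightarrow> complex) \<Rightarrow> bool" where
  "wide_sense_stationary M X \<longleftrightarrow>
     prob_space M \<and>
     (\<forall>t. X t \<in> borel_measurable M \<and> integrable M (\<lambda>\<omega>. (norm (X t \<omega>))\<^sup>2)) \<and>
     (\<forall>t \<tau> s \<sigma>. t - \<tau> = s - \<sigma> \<longrightarrow> autocorrelation M X t \<tau> = autocorrelation M X s \<sigma>)"

(* Complex Hilbert spaces of functions: H is the carrier and ip the inner product, linear in
   its first argument; the values of ip outside H are irrelevant. *)
locale function_hilbert_space =
  fixes H :: "('x \<Rightarrow> complex) set"
    and ip :: "('x \<Rightarrow> complex) \<Rightarrow> ('x \<Rightarrow> complex) \<Rightarrow> complex"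
  assumes zero_mem: "(\<lambda>x. 0) \<in> H"
    and add_mem: "\<lbrakk>f \<in> H; g \<in> H\<rbrakk> \<Longrightarrow> (\<lambda>x. f x + g x) \<in> H"
    and scale_mem: "f \<in> H \<Longrightarrow> (\<lambda>x. c * f x) \<in> H"
    and ip_add: "\<lbrakk>f \<in> H; g \<in> H; h \<in> H\<rbrakk> \<Longrightarrow> ip (\<lambda>x. f x + g x) h = ip f h + ip g h"
    and ip_scale: "\<lbrakk>f \<in> H; h \<in> H\<rbrakk> \<Longrightarrow> ip (\<lambda>x. c * f x) h = c * ip f h"
    and ip_cnj: "\<lbrakk>f \<in> H; g \<in> H\<rbrakk> \<Longrightarrow> ip g f = cnj (ip f g)"
    and ip_nonneg: "f \<in> H \<Longrightarrow> 0 \<le> Re (ip f f)"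
    and ip_definite: "\<lbrakk>f \<in> H; ip f f = 0\<rbrakk> \<Longrightarrow> f = (\<lambda>x. 0)"
    and complete:
      "\<lbrakk>\<And>k. F k \<in> H;
        \<And>e. 0 < e \<Longrightarrow> \<exists>N. \<forall>k\<ge>N. \<forall>l\<ge>N.
          sqrt (Re (ip (\<lambda>x. F k x - F l x) (\<lambda>x. F k x - F l x))) < e\<rbrakk>
       \<Longrightarrow> \<exists>f\<in>H. (\<lambda>k. sqrt (Re (ip (\<lambda>x. F k x - f x) (\<lambda>x. F k x - f x)))) \<longlonglongrightarrow> 0"

locale reproducing_kernel_hilbert_space = function_hilbert_space H ip
  for H :: "('x \<Rightarrow> complex) set"
    and ip :: "('x \<Rightarrow> complex) \<Rightarrow> ('x \<Rightarrow> complex) \<Rightarrow> complex" +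
  fixes K :: "'x \<Rightarrow> 'x \<Rightarrow> complex"
  assumes kernel_mem: "K t \<in> H"
    and reproducing: "f \<in> H \<Longrightarrow> f t = ip f (K t)"

(* The pair of carrier and inner product of H_K. By Moore-Aronszajn a positive-definite K has
   exactly one such space; SOME rather than THE only because ip is arbitrary outside H. *)
definition rkhs :: "('x \<Rightarrow> 'x \<Rightarrow> complex) \<Rightarrow>
    ('x \<Rightarrow> complex) set \<times> (('x \<Rightarrow> complex) \<Rightarrow> ('x \<Rightarrow> complex) \<Rightarrow> complex)" where
  "rkhs K = (SOME (H, ip). reproducing_kernel_hilbert_space H ip K)"

definition rkhs_norm :: "('x \<Rightarrow> 'x \<Rightarrow> complex) \<Rightarrow> ('x \<Rightarrow> complex) \<Rightarrow> real" where
  "rkhs_norm K f = sqrt (Re (snd (rkhs K) f f))"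

definition rkhs_unit_ball :: "('x \<Rightarrow> 'x \<Rightarrow> complex) \<Rightarrow> ('x \<Rightarrow> complex) set" where
  "rkhs_unit_ball K = {f \<in> fst (rkhs K). rkhs_norm K f \<le> 1}"

definition sample_points :: "nat \<Rightarrow> int set" where
  "sample_points n = {- int n + 1..int n}"

definition Linf_norm :: "(real \<Rightarrow> complex) \<Rightarrow> ereal" where
  "Linf_norm f = esssup (lebesgue_on {0..1}) (\<lambda>t. ereal (norm (f t)))"

definition Linf_space :: "(real \<Rightarrow> complex) set" where
  "Linf_space = {f \<in> borel_measurable (lebesgue_on {0..1}). Linf_norm f < \<infinity>}"

(* Functions on J_n are extensional functions on the integers, as in HOL-Library.FuncSet. *)
definition reconstruction_maps :: "nat \<Rightarrow> ((int \<Rightarrow> complex) \<Rightarrow> real \<Rightarrow> complex) set" where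
  "reconstruction_maps n = (sample_points n \<rightarrow>\<^sub>E UNIV) \<rightarrow> Linf_space"

definition samples :: "nat \<Rightarrow> (real \<Rightarrow> complex) \<Rightarrow> int \<Rightarrow> complex" where
  "samples n f = restrict (\<lambda>j. f (real_of_int j)) (sample_points n)"

definition reconstruction_error ::
    "nat \<Rightarrow> ((int \<Rightarrow> complex) \<Rightarrow> real \<Rightarrow> complex) \<Rightarrow> (real \<Rightarrow> real \<Rightarrow> complex) \<Rightarrow> ereal" where
  "reconstruction_error n A K =
     (SUP f \<in> rkhs_unit_ball K. Linf_norm (\<lambda>t. f t - A (samples n f) t))"

definition min_reconstruction_error :: "nat \<Rightarrow> (real \<Rightarrow> real \<Rightarrow> complex) \<Rightarrow> ereal" where
  "min_reconstruction_error n K = (INF A \<in> reconstruction_maps n. reconstruction_error n A K)"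

end

theory Submission
  imports Defs
begin

text \<open>
  Let \<open>K\<close> be the autocorrelation. For any reconstruction map, a function \<open>g\<close> in the unit ball that
  vanishes at all sample points has the same samples as \<open>- g\<close>, so one of \<open>g\<close>, \<open>- g\<close> is reconstructed
  with an error of at least \<open>norm (g (1/2))\<close>. The best such \<open>g\<close> is the normalised component \<open>f\<close> of
  \<open>K (1/2)\<close> orthogonal to the \<open>K j\<close>, \<open>j\<close> a sample point
  (\<open>kernel_residual_exists\<close>, \<open>min_reconstruction_error_ge\<close>). The reproducing property gives
  \<open>f (1/2) = norm f ^ 2\<close>, and by the spectral representation this number is the weighted integral of
  \<open>norm (P \<xi>) ^ 2 * \<rho> \<xi>\<close> with \<open>P \<xi> = cis (\<xi>/2) - (\<Sum>j. c j * cis (j * \<xi>))\<close>; it is at least \<open>m\<close> times the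
  unweighted integral over \<open>{a..b}\<close>. It remains to bound from below, for all coefficients \<open>c\<close>,
  the \<open>L\<^sup>2\<close> norm of \<open>P\<close> over \<open>{a..b}\<close>.

  Shift the interval to \<open>{-\<delta>'..\<delta>'}\<close> and divide by \<open>cis (\<xi>/2)\<close>: the question is how well \<open>1\<close> is
  approximated by the exponentials of frequencies \<open>k - 1/2\<close>, \<open>-n < k \<le> n\<close>. Substitute
  \<open>sin (\<xi>/2) = s * sin u\<close> with \<open>s = sin (\<delta>'/2)\<close>, so that \<open>u\<close> runs through \<open>{-pi/2..pi/2}\<close>. The even
  parts of the exponentials, multiplied by \<open>d\<xi>/du\<close>, become combinations of \<open>cos ((2 * i + 1) * u)\<close> with
  \<open>i < n\<close> (a Chebyshev system of the second kind), hence \<open>h u = cos ((2 * n + 1) * u)\<close> annihilates all of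
  them, and the odd parts are annihilated by symmetry. By duality the squared distance is at least
  \<open>I\<^sup>2 / pi\<close>, where \<open>I\<close> is the integral of \<open>h\<close> against \<open>d\<xi>/du\<close>; here \<open>d\<xi>/du \<le> 2\<close> is used
  (\<open>trigonometric_approximation_lower_bound\<close>).

  With \<open>T = tan (\<delta>'/4)\<close> one has \<open>d\<xi>/du = 4 * T * cos u / norm (1 + T\<^sup>2 * cis (2 * u))\<close>. Since
  \<open>1 / norm (1 + z)\<close> is the squared modulus of the binomial series of \<open>(1 + z) powr (-1/2)\<close>, its
  Fourier coefficients are explicit sums. Up to sign, \<open>I\<close> is a multiple of the difference of two
  consecutive ones, which is a sum of nonnegative terms; the first of them has size
  \<open>T ^ (2 * n + 1)\<close> up to polynomial factors in \<open>n\<close> (\<open>inverse_norm_fourier_lower_bound\<close>). Finally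
  \<open>tan y \<ge> y + y ^ 3 / 3\<close> turns powers of \<open>T\<close> into powers of \<open>\<delta>'/4\<close>, with a gain that absorbs the
  remaining polynomial factors (\<open>trigonometric_bound_ge_power_bound\<close>).

  The Hilbert space of \<open>K\<close> is introduced by a choice among all reproducing kernel Hilbert spaces with
  this kernel, so the argument applies only once such a space is known to exist; this is the
  Moore-Aronszajn theorem (\<open>moore_aronszajn\<close>). As a finite combination of kernel functions, \<open>f\<close> lies
  in whichever space is chosen, with the same norm.
\<close>

section \<open>Existence of the reproducing kernel Hilbert space\<close>

text \<open>
  A finite combination of kernel functions is represented by the list of its coefficients and
  points, repetitions allowed. Addition is then concatenation, and sesquilinearity holds without any
  bookkeeping of supports.
\<close>
definition gram :: "('x \<Rightarrow> 'x \<Rightarrow> complex) \<Rightarrow> (complex \<times> 'x) list \<Rightarrow> (complex \<times> 'x) list \<Rightarrow> complex" where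
  "gram K xs ys = (\<Sum>(c, s)\<leftarrow>xs. \<Sum>(d, t)\<leftarrow>ys. c * cnj d * K s t)"

definition scale_list :: "complex \<Rightarrow> (complex \<times> 'x) list \<Rightarrow> (complex \<times> 'x) list" where
  "scale_list r xs = map (\<lambda>(c, s). (r * c, s)) xs"

definition diff_list :: "(complex \<times> 'x) list \<Rightarrow> (complex \<times> 'x) list \<Rightarrow> (complex \<times> 'x) list" where
  "diff_list xs ys = xs @ scale_list (-1) ys"

lemma gram_append_left: "gram K (xs @ ys) zs = gram K xs zs + gram K ys zs"
  by (simp add: gram_def)

lemma gram_append_right: "gram K xs (ys @ zs) = gram K xs ys + gram K xs zs"
  by (induction xs) (auto simp: gram_def)

lemma gram_scale_left: "gram K (scale_list r xs) ys = r * gram K xs ys"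
proof (induction xs)
  case (Cons p xs)
  have "(\<Sum>(d, t)\<leftarrow>ys. r * c * cnj d * K s t) = r * (\<Sum>(d, t)\<leftarrow>ys. c * cnj d * K s t)" for c s
    by (induction ys) (auto simp: algebra_simps)
  with Cons show ?case by (cases p) (simp add: gram_def scale_list_def distrib_left)
qed (simp add: gram_def scale_list_def)

lemma gram_scale_right: "gram K xs (scale_list r ys) = cnj r * gram K xs ys"
proof (induction xs)
  case (Cons p xs)
  have "(\<Sum>(d, t)\<leftarrow>scale_list r ys. c * cnj d * K s t) = cnj r * (\<Sum>(d, t)\<leftarrow>ys. c * cnj d * K s t)" for c s
    by (induction ys) (auto simp: algebra_simps scale_list_def)
  with Cons show ?case by (cases p) (simp add: gram_def distrib_left)
qed (simp add: gram_def)

lemma gram_diff_left: "gram K (diff_list xs ys) zs = gram K xs zs - gram K ys zs"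
  by (simp add: diff_list_def gram_append_left gram_scale_left)

lemma gram_diff_right: "gram K xs (diff_list ys zs) = gram K xs ys - gram K xs zs"
  by (simp add: diff_list_def gram_append_right gram_scale_right)

lemmas gram_simps = gram_append_left gram_append_right gram_scale_left gram_scale_right
  gram_diff_left gram_diff_right

lemma gram_singletons: "gram K [(1, s)] [(1, t)] = K s t"
  by (simp add: gram_def)

lemma gram_Nil_right: "gram K xs [] = 0"
  by (induction xs) (auto simp: gram_def)

lemma gram_Cons_right: "gram K xs ((d, t) # ys) = cnj d * gram K xs [(1, t)] + gram K xs ys"
  using gram_append_right[of K xs "scale_list d [(1, t)]" ys]
  by (simp add: gram_scale_right) (simp add: scale_list_def)

text \<open>
  Positivity over lists with repeated points is equivalent to positivity over distinct points, as
  equal points can be merged by adding their coefficients.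
\<close>
locale positive_definite_kernel =
  fixes K :: "'x \<Rightarrow> 'x \<Rightarrow> complex"
  assumes hermitian: "K t s = cnj (K s t)"
    and gram_nonneg: "0 \<le> Re (gram K xs xs)"
begin

abbreviation G where "G \<equiv> gram K"

definition rep_norm :: "(complex \<times> 'x) list \<Rightarrow> real" where
  "rep_norm xs = sqrt (Re (G xs xs))"

lemma gram_cnj: "G ys xs = cnj (G xs ys)"
proof -
  have single: "G ys [(1, t)] = cnj (G [(1, t)] ys)" for t ys
    by (induction ys) (auto simp: gram_def hermitian[of _ t])
  show ?thesis
  proof (induction xs)
    case Nil
    show ?case by (simp add: gram_Nil_right) (simp add: gram_def)
  next
    case (Cons p xs)
    obtain d t where p: "p = (d, t)" by (cases p)
    have "G (p # xs) ys = d * G [(1, t)] ys + G xs ys"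
      using gram_append_left[of K "scale_list d [(1, t)]" xs ys] unfolding gram_scale_left
      by (simp add: scale_list_def p)
    thus ?case using Cons by (simp add: p gram_Cons_right[of K ys] single)
  qed
qed

lemma rep_norm_nonneg: "0 \<le> rep_norm xs"
  by (simp add: rep_norm_def gram_nonneg)

lemma gram_self: "G xs xs = of_real ((rep_norm xs)\<^sup>2)"
  using gram_cnj[of xs xs] gram_nonneg[of xs] by (simp add: rep_norm_def complex_eq_iff)

text \<open>
  The form may be degenerate, so the usual division by the norm of \<open>ys\<close> is not always possible.
  Positivity at \<open>xs - r * w * ys\<close> for all real \<open>r\<close>, where \<open>w\<close> is the inner product itself, covers
  both cases: for degenerate \<open>ys\<close> a large \<open>r\<close> forces \<open>w = 0\<close>.
\<close>
lemma gram_cauchy_schwarz: "norm (G xs ys) \<le> rep_norm xs * rep_norm ys"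
proof -
  define w where "w = G xs ys"
  have quad: "0 \<le> (rep_norm xs)\<^sup>2 - 2 * r * (norm w)\<^sup>2 + r\<^sup>2 * (norm w)\<^sup>2 * (rep_norm ys)\<^sup>2" for r :: real
  proof -
    define zs where "zs = diff_list xs (scale_list (of_real r * w) ys)"
    have yx: "G ys xs = cnj w" using gram_cnj[of ys xs] by (simp add: w_def)
    have "G zs zs = of_real ((rep_norm xs)\<^sup>2) - 2 * of_real r * (w * cnj w)
        + (of_real r)\<^sup>2 * (w * cnj w) * of_real ((rep_norm ys)\<^sup>2)"
      unfolding zs_def gram_simps gram_self yx w_def[symmetric]
      by (simp add: algebra_simps power2_eq_square)
    also have "\<dots> = of_real ((rep_norm xs)\<^sup>2 - 2 * r * (norm w)\<^sup>2 + r\<^sup>2 * (norm w)\<^sup>2 * (rep_norm ys)\<^sup>2)"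
      unfolding complex_norm_square[symmetric] by simp
    finally show ?thesis using gram_nonneg[of zs] by simp
  qed
  have "(norm w)\<^sup>2 \<le> (rep_norm xs)\<^sup>2 * (rep_norm ys)\<^sup>2"
  proof (cases "rep_norm ys = 0")
    case True
    have "(norm w)\<^sup>2 = 0"
    proof (rule ccontr)
      assume "(norm w)\<^sup>2 \<noteq> 0"
      thus False using quad[of "((rep_norm xs)\<^sup>2 + 1) / (2 * (norm w)\<^sup>2)"] True by (simp add: field_simps)
    qed
    thus ?thesis by simp
  next
    case False
    hence Y: "0 < (rep_norm ys)\<^sup>2" by simp
    have "X - 2 * (1 / Y) * W + (1 / Y)\<^sup>2 * W * Y = X - W / Y" if "0 < Y" for X Y W :: real
      using that by (simp add: field_simps power2_eq_square)
    note this[OF Y, of "(rep_norm xs)\<^sup>2" "(norm w)\<^sup>2"]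
    with quad[of "1 / (rep_norm ys)\<^sup>2"] have "(norm w)\<^sup>2 / (rep_norm ys)\<^sup>2 \<le> (rep_norm xs)\<^sup>2" by simp
    thus ?thesis unfolding pos_divide_le_eq[OF Y] .
  qed
  hence "(norm w)\<^sup>2 \<le> (rep_norm xs * rep_norm ys)\<^sup>2" by (simp add: power_mult_distrib)
  thus ?thesis
    unfolding w_def by (rule power2_le_imp_le) (simp add: rep_norm_nonneg)
qed

lemma rep_norm_eqI: "G xs xs = G ys ys \<Longrightarrow> rep_norm xs = rep_norm ys"
  by (simp add: rep_norm_def)

lemma rep_norm_append: "rep_norm (xs @ ys) \<le> rep_norm xs + rep_norm ys"
proof (rule power2_le_imp_le)
  have "of_real ((rep_norm (xs @ ys))\<^sup>2) = G (xs @ ys) (xs @ ys)" by (simp add: gram_self)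
  also have "\<dots> = of_real ((rep_norm xs)\<^sup>2) + of_real ((rep_norm ys)\<^sup>2) + (G xs ys + cnj (G xs ys))"
    by (simp only: gram_simps gram_self gram_cnj[of ys xs]) simp
  also have "\<dots> = of_real ((rep_norm xs)\<^sup>2 + (rep_norm ys)\<^sup>2 + 2 * Re (G xs ys))"
    by (simp only: complex_add_cnj) simp
  finally have "(rep_norm (xs @ ys))\<^sup>2 = (rep_norm xs)\<^sup>2 + (rep_norm ys)\<^sup>2 + 2 * Re (G xs ys)"
    by (simp only: of_real_eq_iff)
  also have "\<dots> \<le> (rep_norm xs)\<^sup>2 + (rep_norm ys)\<^sup>2 + 2 * (rep_norm xs * rep_norm ys)"
    using gram_cauchy_schwarz[of xs ys] complex_Re_le_cmod[of "G xs ys"] by simp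
  finally show "(rep_norm (xs @ ys))\<^sup>2 \<le> (rep_norm xs + rep_norm ys)\<^sup>2"
    by (simp add: power2_eq_square algebra_simps)
qed (use rep_norm_nonneg in auto)

lemma rep_norm_scale: "rep_norm (scale_list r xs) = norm r * rep_norm xs"
proof -
  have "G (scale_list r xs) (scale_list r xs) = (r * cnj r) * G xs xs"
    by (simp add: gram_simps)
  also have "\<dots> = of_real ((norm r * rep_norm xs)\<^sup>2)"
    by (simp only: complex_norm_square[symmetric] gram_self) (simp add: power_mult_distrib)
  finally show ?thesis using rep_norm_nonneg[of xs] by (simp add: rep_norm_def)
qed

lemma rep_norm_diff_commute: "rep_norm (diff_list xs ys) = rep_norm (diff_list ys xs)"
  by (rule rep_norm_eqI) (simp add: gram_simps)

lemma rep_norm_diff_triangle: "rep_norm (diff_list xs zs) \<le> rep_norm (diff_list xs ys) + rep_norm (diff_list ys zs)"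
proof -
  have "rep_norm (diff_list xs zs) = rep_norm (diff_list xs ys @ diff_list ys zs)"
    by (rule rep_norm_eqI) (simp add: gram_simps)
  thus ?thesis using rep_norm_append by simp
qed

definition rep_cauchy :: "(nat \<Rightarrow> (complex \<times> 'x) list) \<Rightarrow> bool" where
  "rep_cauchy a \<longleftrightarrow> (\<forall>e>0. \<exists>M. \<forall>m\<ge>M. \<forall>n\<ge>M. rep_norm (diff_list (a m) (a n)) < e)"

lemma rep_cauchy_const: "rep_cauchy (\<lambda>_. xs)"
proof -
  have "rep_norm (diff_list xs xs) = 0" by (simp add: rep_norm_def gram_simps)
  thus ?thesis by (simp add: rep_cauchy_def)
qed

lemma rep_cauchy_append:
  assumes "rep_cauchy a" "rep_cauchy b" shows "rep_cauchy (\<lambda>n. a n @ b n)"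
  unfolding rep_cauchy_def
proof (intro allI impI)
  fix e :: real assume "0 < e"
  then obtain M1 M2 where M: "\<forall>m\<ge>M1. \<forall>n\<ge>M1. rep_norm (diff_list (a m) (a n)) < e / 2"
      "\<forall>m\<ge>M2. \<forall>n\<ge>M2. rep_norm (diff_list (b m) (b n)) < e / 2"
    using assms unfolding rep_cauchy_def by (meson half_gt_zero)
  have "rep_norm (diff_list (a m @ b m) (a n @ b n)) \<le> rep_norm (diff_list (a m) (a n)) + rep_norm (diff_list (b m) (b n))" for m n
  proof -
    have "rep_norm (diff_list (a m @ b m) (a n @ b n)) = rep_norm (diff_list (a m) (a n) @ diff_list (b m) (b n))"
      by (rule rep_norm_eqI) (simp add: gram_simps)
    thus ?thesis using rep_norm_append by simp
  qed
  with M show "\<exists>M. \<forall>m\<ge>M. \<forall>n\<ge>M. rep_norm (diff_list (a m @ b m) (a n @ b n)) < e"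
    by (intro exI[of _ "max M1 M2"]) (smt (verit) field_sum_of_halves max.bounded_iff)
qed

lemma rep_cauchy_scale:
  assumes "rep_cauchy a" shows "rep_cauchy (\<lambda>n. scale_list r (a n))"
  unfolding rep_cauchy_def
proof (intro allI impI)
  fix e :: real assume "0 < e"
  hence "0 < e / (norm r + 1)" by (simp add: add_nonneg_pos)
  then obtain M where M: "\<forall>m\<ge>M. \<forall>n\<ge>M. rep_norm (diff_list (a m) (a n)) < e / (norm r + 1)"
    using assms unfolding rep_cauchy_def by blast
  have "rep_norm (diff_list (scale_list r (a m)) (scale_list r (a n))) < e" if "m \<ge> M" "n \<ge> M" for m n
  proof -
    have "rep_norm (diff_list (scale_list r (a m)) (scale_list r (a n))) = rep_norm (scale_list r (diff_list (a m) (a n)))"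
      by (rule rep_norm_eqI) (simp add: gram_simps algebra_simps)
    also have "\<dots> \<le> (norm r + 1) * rep_norm (diff_list (a m) (a n))"
      by (simp add: rep_norm_scale rep_norm_nonneg mult_right_mono)
    also have "\<dots> < (norm r + 1) * (e / (norm r + 1))"
      using M that by (intro mult_strict_left_mono) (auto simp: add_nonneg_pos)
    also have "\<dots> = e" by (simp add: add_nonneg_eq_0_iff)
    finally show ?thesis .
  qed
  thus "\<exists>M. \<forall>m\<ge>M. \<forall>n\<ge>M. rep_norm (diff_list (scale_list r (a m)) (scale_list r (a n))) < e" by blast
qed

lemma rep_cauchy_diff: "rep_cauchy a \<Longrightarrow> rep_cauchy b \<Longrightarrow> rep_cauchy (\<lambda>n. diff_list (a n) (b n))"
  unfolding diff_list_def by (intro rep_cauchy_append rep_cauchy_scale)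

lemma rep_cauchy_bounded:
  assumes "rep_cauchy a" obtains B where "0 < B" "\<And>n. rep_norm (a n) \<le> B"
proof -
  from assms obtain M where M: "\<forall>m\<ge>M. \<forall>n\<ge>M. rep_norm (diff_list (a m) (a n)) < 1"
    unfolding rep_cauchy_def by (meson zero_less_one)
  define B where "B = Max ((\<lambda>n. rep_norm (a n)) ` {..M}) + 1"
  have le: "rep_norm (a n) \<le> B - 1" if "n \<le> M" for n
    unfolding B_def using that by (auto intro!: Max_ge)
  have "rep_norm (a n) \<le> B" for n
  proof (cases "n \<le> M")
    case False
    have "rep_norm (a n) = rep_norm (diff_list (a n) (a M) @ a M)"
      by (rule rep_norm_eqI) (simp add: gram_simps)
    also have "\<dots> \<le> rep_norm (diff_list (a n) (a M)) + rep_norm (a M)" by (rule rep_norm_append)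
    also have "\<dots> \<le> 1 + (B - 1)"
    proof (rule add_mono)
      show "rep_norm (diff_list (a n) (a M)) \<le> 1"
        using M False by (intro less_imp_le) auto
    qed (use le[of M] in simp)
    finally show ?thesis by simp
  qed (use le[of n] in simp)
  moreover have "0 < B" using le[of M] rep_norm_nonneg[of "a M"] by simp
  ultimately show ?thesis using that by blast
qed

lemma convergent_gram:
  assumes "rep_cauchy a" "rep_cauchy b" shows "convergent (\<lambda>n. G (a n) (b n))"
proof -
  obtain A where A: "0 < A" "\<And>n. rep_norm (a n) \<le> A" using rep_cauchy_bounded[OF assms(1)] by blast
  obtain B where B: "0 < B" "\<And>n. rep_norm (b n) \<le> B" using rep_cauchy_bounded[OF assms(2)] by blast
  have "Cauchy (\<lambda>n. G (a n) (b n))"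
    unfolding Cauchy_def
  proof (intro allI impI)
    fix e :: real assume "0 < e"
    then have "0 < e / (2 * A)" "0 < e / (2 * B)" using A B by auto
    then obtain M1 M2 where M: "\<forall>m\<ge>M1. \<forall>n\<ge>M1. rep_norm (diff_list (a m) (a n)) < e / (2 * B)"
        "\<forall>m\<ge>M2. \<forall>n\<ge>M2. rep_norm (diff_list (b m) (b n)) < e / (2 * A)"
      using assms unfolding rep_cauchy_def by meson
    have "dist (G (a m) (b m)) (G (a n) (b n)) < e" if mn: "m \<ge> max M1 M2" "n \<ge> max M1 M2" for m n
    proof -
      have "G (a m) (b m) - G (a n) (b n)
          = G (diff_list (a m) (a n)) (b m) + G (a n) (diff_list (b m) (b n))"
        by (simp add: gram_simps)
      hence "dist (G (a m) (b m)) (G (a n) (b n))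
          \<le> norm (G (diff_list (a m) (a n)) (b m)) + norm (G (a n) (diff_list (b m) (b n)))"
        by (simp add: dist_norm norm_triangle_ineq)
      also have "\<dots> \<le> rep_norm (diff_list (a m) (a n)) * B + A * rep_norm (diff_list (b m) (b n))"
        by (intro add_mono order_trans[OF gram_cauchy_schwarz] mult_mono A B rep_norm_nonneg order_refl)
           (use A B in auto)
      also have "\<dots> < e / (2 * B) * B + A * (e / (2 * A))"
        using M mn A B by (intro add_strict_mono mult_strict_left_mono mult_strict_right_mono) auto
      also have "\<dots> = e" using A B by simp
      finally show ?thesis .
    qed
    thus "\<exists>M. \<forall>m\<ge>M. \<forall>n\<ge>M. dist (G (a m) (b m)) (G (a n) (b n)) < e" by blast
  qed
  thus ?thesis by (simp add: Cauchy_convergent_iff)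
qed

text \<open>
  A Cauchy sequence that tends weakly to zero on the kernel functions tends weakly to zero along
  every Cauchy sequence \<open>b\<close>: the limit along a fixed member \<open>b M\<close> is a finite combination of the given
  ones, and the tail of \<open>b\<close> stays close to \<open>b M\<close>. This is what makes the inner product of the
  completion depend on the pointwise limits only.
\<close>
lemma gram_tendsto_0:
  assumes d: "rep_cauchy d" and b: "rep_cauchy b" and lim: "\<And>t. (\<lambda>n. G (d n) [(1, t)]) \<longlonglongrightarrow> 0"
  shows "(\<lambda>n. G (d n) (b n)) \<longlonglongrightarrow> 0"
proof (rule LIMSEQ_I)
  fix e :: real assume e: "0 < e"
  have fin: "(\<lambda>n. G (d n) xs) \<longlonglongrightarrow> 0" for xs
  proof (induction xs)
    case (Cons p xs)
    show ?case
      using tendsto_add[OF tendsto_mult[OF tendsto_const[of "cnj (fst p)"] lim[of "snd p"]] Cons]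
      by (cases p) (simp add: gram_Cons_right[of K _ _ _ xs])
  qed (simp add: gram_Nil_right)
  obtain D where D: "0 < D" "\<And>n. rep_norm (d n) \<le> D" using rep_cauchy_bounded[OF d] by blast
  have "0 < e / (2 * D)" using e D by simp
  then obtain M where M: "\<forall>m\<ge>M. \<forall>n\<ge>M. rep_norm (diff_list (b m) (b n)) < e / (2 * D)"
    using b unfolding rep_cauchy_def by meson
  obtain M' where M': "\<forall>n\<ge>M'. norm (G (d n) (b M)) < e / 2"
    using LIMSEQ_D[OF fin, of "e / 2" "b M"] e by auto
  have "norm (G (d n) (b n)) < e" if n: "n \<ge> max M M'" for n
  proof -
    have "G (d n) (b n) = G (d n) (b M) + G (d n) (diff_list (b n) (b M))"
      by (simp add: gram_simps)
    hence "norm (G (d n) (b n)) \<le> norm (G (d n) (b M)) + norm (G (d n) (diff_list (b n) (b M)))"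
      by (simp add: norm_triangle_ineq)
    also have "\<dots> \<le> norm (G (d n) (b M)) + D * rep_norm (diff_list (b n) (b M))"
      by (intro add_mono order_trans[OF gram_cauchy_schwarz] mult_mono D rep_norm_nonneg order_refl)
         (use D in auto)
    also have "\<dots> < e / 2 + D * (e / (2 * D))"
      using M M' n D by (intro add_strict_mono mult_strict_left_mono) auto
    also have "\<dots> = e" using D by simp
    finally show ?thesis .
  qed
  thus "\<exists>M. \<forall>n\<ge>M. norm (G (d n) (b n) - 0) < e"
    by (intro exI[of _ "max M M'"]) auto
qed

text \<open>
  The completion consists of functions rather than of classes of Cauchy sequences: such a sequence is
  identified with the function that it converges to pointwise.
\<close>
definition represents :: "(nat \<Rightarrow> (complex \<times> 'x) list) \<Rightarrow> ('x \<Rightarrow> complex) \<Rightarrow> bool" where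
  "represents a f \<longleftrightarrow> rep_cauchy a \<and> (\<forall>t. (\<lambda>n. G (a n) [(1, t)]) \<longlonglongrightarrow> f t)"

definition completion :: "('x \<Rightarrow> complex) set" where
  "completion = {f. \<exists>a. represents a f}"

text \<open>
  The representing sequences are chosen arbitrarily; independence of the choice is
  \<open>completion_ip_tendsto\<close>.
\<close>
definition completion_ip :: "('x \<Rightarrow> complex) \<Rightarrow> ('x \<Rightarrow> complex) \<Rightarrow> complex" where
  "completion_ip f g = lim (\<lambda>n. G ((SOME a. represents a f) n) ((SOME b. represents b g) n))"

lemma represents_add: "represents a f \<Longrightarrow> represents b g \<Longrightarrow> represents (\<lambda>n. a n @ b n) (\<lambda>t. f t + g t)"
  by (auto simp: represents_def gram_append_left intro!: rep_cauchy_append tendsto_add)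

lemma represents_scale: "represents a f \<Longrightarrow> represents (\<lambda>n. scale_list c (a n)) (\<lambda>t. c * f t)"
  by (auto simp: represents_def gram_scale_left intro!: rep_cauchy_scale tendsto_mult tendsto_const)

lemma represents_diff: "represents a f \<Longrightarrow> represents b g \<Longrightarrow> represents (\<lambda>n. diff_list (a n) (b n)) (\<lambda>t. f t - g t)"
  by (auto simp: represents_def gram_diff_left intro!: rep_cauchy_diff tendsto_diff)

lemma represents_kernel: "represents (\<lambda>_. [(1, t)]) (K t)"
  by (simp add: represents_def rep_cauchy_const gram_singletons)

lemma represents_same_gram_diff_tendsto_0:
  assumes "represents a f" "represents a' f" "rep_cauchy b"
  shows "(\<lambda>n. G (a n) (b n) - G (a' n) (b n)) \<longlonglongrightarrow> 0"
proof -
  have "(\<lambda>n. G (diff_list (a n) (a' n)) (b n)) \<longlonglongrightarrow> 0"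
    using represents_diff[OF assms(1,2)] assms(3)
    by (rule_tac gram_tendsto_0[of "\<lambda>n. diff_list (a n) (a' n)" b]) (simp_all add: represents_def)
  thus ?thesis by (simp add: gram_diff_left)
qed

lemma completion_ip_tendsto:
  assumes f: "represents a f" and g: "represents b g"
  shows "(\<lambda>n. G (a n) (b n)) \<longlonglongrightarrow> completion_ip f g"
proof -
  define a' b' where "a' = (SOME a. represents a f)" and "b' = (SOME b. represents b g)"
  have f': "represents a' f" and g': "represents b' g"
    unfolding a'_def b'_def by (rule someI[of "\<lambda>a. represents a f", OF f], rule someI[of "\<lambda>b. represents b g", OF g])
  have lim: "(\<lambda>n. G (a' n) (b' n)) \<longlonglongrightarrow> completion_ip f g"
    using convergent_gram[of a' b'] f' g'
    by (simp add: represents_def completion_ip_def a'_def b'_def convergent_LIMSEQ_iff)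
  have 1: "(\<lambda>n. G (a n) (b n) - G (a' n) (b n)) \<longlonglongrightarrow> 0"
    using f f' g by (intro represents_same_gram_diff_tendsto_0) (auto simp: represents_def)
  have "(\<lambda>n. G (b n) (a' n) - G (b' n) (a' n)) \<longlonglongrightarrow> 0"
    using g g' f' by (intro represents_same_gram_diff_tendsto_0) (auto simp: represents_def)
  hence "(\<lambda>n. cnj (G (b n) (a' n) - G (b' n) (a' n))) \<longlonglongrightarrow> cnj 0"
    by (rule tendsto_cnj)
  hence 2: "(\<lambda>n. G (a' n) (b n) - G (a' n) (b' n)) \<longlonglongrightarrow> 0"
    by (simp add: gram_cnj[symmetric])
  from tendsto_add[OF tendsto_add[OF 1 2] lim] show ?thesis by simp
qed

lemma completion_norm_tendsto:
  assumes "represents a f"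
  shows "(\<lambda>n. rep_norm (a n)) \<longlonglongrightarrow> sqrt (Re (completion_ip f f))"
  unfolding rep_norm_def by (intro tendsto_intros completion_ip_tendsto assms)

text \<open>
  Diagonal argument: each \<open>F k\<close> is approximated within \<open>1 / (k + 1)\<close> by a single list \<open>v k\<close>; the
  sequence of these lists is Cauchy and represents the limit.
\<close>
lemma completion_complete:
  assumes F: "\<And>k. F k \<in> completion"
    and C: "\<And>e. 0 < e \<Longrightarrow> \<exists>M. \<forall>k\<ge>M. \<forall>l\<ge>M.
      sqrt (Re (completion_ip (\<lambda>x. F k x - F l x) (\<lambda>x. F k x - F l x))) < e"
  shows "\<exists>f\<in>completion. (\<lambda>k. sqrt (Re (completion_ip (\<lambda>x. F k x - f x) (\<lambda>x. F k x - f x)))) \<longlonglongrightarrow> 0"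
proof -
  obtain a where a: "\<And>k. represents (a k) (F k)"
    using F unfolding completion_def by simp metis
  have "\<exists>M. \<forall>n\<ge>M. rep_norm (diff_list (a k n) (a k M)) < 1 / real (Suc k)" for k
    using a[of k] unfolding represents_def rep_cauchy_def
    by (metis le_refl of_nat_0_less_iff zero_less_Suc zero_less_divide_1_iff)
  then obtain M where M: "\<And>k n. n \<ge> M k \<Longrightarrow> rep_norm (diff_list (a k n) (a k (M k))) < 1 / real (Suc k)"
    by metis
  define v where "v k = a k (M k)" for k
  have v_diff: "rep_norm (diff_list (v k) (v l)) \<le> 1 / real (Suc k) + 1 / real (Suc l)
      + sqrt (Re (completion_ip (\<lambda>x. F k x - F l x) (\<lambda>x. F k x - F l x)))" for k l
  proof (rule tendsto_lowerbound)
    show "(\<lambda>n. 1 / real (Suc k) + 1 / real (Suc l) + rep_norm (diff_list (a k n) (a l n)))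
      \<longlonglongrightarrow> 1 / real (Suc k) + 1 / real (Suc l)
      + sqrt (Re (completion_ip (\<lambda>x. F k x - F l x) (\<lambda>x. F k x - F l x)))"
      by (intro tendsto_intros completion_norm_tendsto represents_diff a)
    show "\<forall>\<^sub>F n in sequentially. rep_norm (diff_list (v k) (v l))
        \<le> 1 / real (Suc k) + 1 / real (Suc l) + rep_norm (diff_list (a k n) (a l n))"
      using eventually_ge_at_top[of "max (M k) (M l)"]
    proof eventually_elim
      case (elim n)
      have "rep_norm (diff_list (v k) (v l)) \<le> rep_norm (diff_list (v k) (a k n)) + (rep_norm (diff_list (a k n) (a l n))
          + rep_norm (diff_list (a l n) (v l)))"
        by (intro order_trans[OF rep_norm_diff_triangle add_left_mono] rep_norm_diff_triangle)
      moreover have "rep_norm (diff_list (v k) (a k n)) < 1 / real (Suc k)"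
        using M[of k n] elim by (simp add: v_def rep_norm_diff_commute[of "a k (M k)"])
      moreover have "rep_norm (diff_list (a l n) (v l)) < 1 / real (Suc l)"
        using M[of l n] elim by (simp add: v_def)
      ultimately show ?case by linarith
    qed
  qed simp
  have inv: "\<exists>M. \<forall>k\<ge>M. 1 / real (Suc k) < e" if "0 < e" for e :: real
    using LIMSEQ_D[OF LIMSEQ_inverse_real_of_nat that] by (simp add: inverse_eq_divide)
  have v_cauchy: "rep_cauchy v"
    unfolding rep_cauchy_def
  proof (intro allI impI)
    fix e :: real assume "0 < e"
    hence e3: "0 < e / 3" by simp
    obtain M1 where M1: "\<forall>k\<ge>M1. 1 / real (Suc k) < e / 3" using inv[OF e3] by blast
    obtain M2 where M2: "\<forall>k\<ge>M2. \<forall>l\<ge>M2.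
        sqrt (Re (completion_ip (\<lambda>x. F k x - F l x) (\<lambda>x. F k x - F l x))) < e / 3"
      using C[OF e3] by blast
    have "rep_norm (diff_list (v k) (v l)) < e" if kl: "k \<ge> max M1 M2" "l \<ge> max M1 M2" for k l
    proof -
      have "1 / real (Suc k) < e / 3" "1 / real (Suc l) < e / 3"
        "sqrt (Re (completion_ip (\<lambda>x. F k x - F l x) (\<lambda>x. F k x - F l x))) < e / 3"
        using M1 M2 kl by auto
      thus ?thesis using v_diff[of k l] by linarith
    qed
    thus "\<exists>M. \<forall>k\<ge>M. \<forall>l\<ge>M. rep_norm (diff_list (v k) (v l)) < e" by blast
  qed
  define f where "f t = lim (\<lambda>n. G (v n) [(1, t)])" for t
  have f: "represents v f"
    unfolding represents_def f_def using v_cauchy convergent_gram[OF v_cauchy rep_cauchy_const]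
    by (simp add: convergent_LIMSEQ_iff)
  have "(\<lambda>k. sqrt (Re (completion_ip (\<lambda>x. F k x - f x) (\<lambda>x. F k x - f x)))) \<longlonglongrightarrow> 0"
  proof (rule LIMSEQ_I)
    fix e :: real assume "0 < e"
    hence e3: "0 < e / 3" by simp
    obtain M1 where M1: "\<forall>k\<ge>M1. 1 / real (Suc k) < e / 3" using inv[OF e3] by blast
    obtain M2 where M2: "\<forall>k\<ge>M2. \<forall>l\<ge>M2. rep_norm (diff_list (v k) (v l)) < e / 3"
      using v_cauchy e3 unfolding rep_cauchy_def by blast
    have "norm (sqrt (Re (completion_ip (\<lambda>x. F k x - f x) (\<lambda>x. F k x - f x))) - 0) < e"
      if k: "k \<ge> max M1 M2" for k
    proof -
      let ?n = "sqrt (Re (completion_ip (\<lambda>x. F k x - f x) (\<lambda>x. F k x - f x)))"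
      have lim: "(\<lambda>n. rep_norm (diff_list (a k n) (v n))) \<longlonglongrightarrow> ?n"
        by (intro completion_norm_tendsto represents_diff a f)
      have "?n \<le> e / 3 + e / 3"
      proof (rule tendsto_upperbound[OF lim])
        show "\<forall>\<^sub>F n in sequentially. rep_norm (diff_list (a k n) (v n)) \<le> e / 3 + e / 3"
          using eventually_ge_at_top[of "max M2 (M k)"]
        proof eventually_elim
          case (elim n)
          have "rep_norm (diff_list (a k n) (v n)) \<le> rep_norm (diff_list (a k n) (v k)) + rep_norm (diff_list (v k) (v n))"
            by (rule rep_norm_diff_triangle)
          moreover have "rep_norm (diff_list (a k n) (v k)) < 1 / real (Suc k)"
            using M[of k n] elim by (simp add: v_def)
          moreover have "1 / real (Suc k) < e / 3" "rep_norm (diff_list (v k) (v n)) < e / 3"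
            using M1 M2 k elim by auto
          ultimately show ?case by linarith
        qed
      qed simp
      moreover have "0 \<le> ?n"
        by (rule tendsto_lowerbound[OF lim]) (auto simp: rep_norm_nonneg)
      ultimately show ?thesis using \<open>0 < e\<close> by simp
    qed
    thus "\<exists>M. \<forall>k\<ge>M. norm (sqrt (Re (completion_ip (\<lambda>x. F k x - f x) (\<lambda>x. F k x - f x))) - 0) < e" by blast
  qed
  thus ?thesis using f unfolding completion_def by blast
qed

text \<open>
  The kernel function at \<open>t\<close> is represented by the constant sequence \<open>[(1, t)]\<close>, so the reproducing
  property is the definition of a representing sequence. Definiteness follows from Cauchy-Schwarz:
  norms that tend to zero force the pointwise limits to vanish.
\<close>
lemma moore_aronszajn: "reproducing_kernel_hilbert_space completion completion_ip K"
proof unfold_locales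
  show "(\<lambda>x. 0) \<in> completion"
    unfolding completion_def using represents_scale[OF represents_kernel, of 0] by auto
  show "(\<lambda>x. f x + g x) \<in> completion" if "f \<in> completion" "g \<in> completion" for f g
    using that unfolding completion_def by (auto intro: represents_add)
  show "(\<lambda>x. c * f x) \<in> completion" if "f \<in> completion" for f c
    using that unfolding completion_def by (auto intro: represents_scale)
  show "completion_ip (\<lambda>x. f x + g x) h = completion_ip f h + completion_ip g h"
    if "f \<in> completion" "g \<in> completion" "h \<in> completion" for f g h
  proof -
    from that obtain a b c where r: "represents a f" "represents b g" "represents c h"
      unfolding completion_def by blast
    show ?thesis
      using completion_ip_tendsto[OF represents_add[OF r(1,2)] r(3)]
        tendsto_add[OF completion_ip_tendsto[OF r(1,3)] completion_ip_tendsto[OF r(2,3)]]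
      unfolding gram_append_left by (rule LIMSEQ_unique)
  qed
  show "completion_ip (\<lambda>x. c * f x) h = c * completion_ip f h"
    if "f \<in> completion" "h \<in> completion" for c f h
  proof -
    from that obtain a b where r: "represents a f" "represents b h"
      unfolding completion_def by blast
    show ?thesis
      using completion_ip_tendsto[OF represents_scale[OF r(1)] r(2)]
        tendsto_mult[OF tendsto_const completion_ip_tendsto[OF r]]
      unfolding gram_scale_left by (rule LIMSEQ_unique)
  qed
  show "completion_ip g f = cnj (completion_ip f g)"
    if "f \<in> completion" "g \<in> completion" for f g
  proof -
    from that obtain a b where r: "represents a f" "represents b g"
      unfolding completion_def by blast
    show ?thesis
      using completion_ip_tendsto[OF r(2,1)] tendsto_cnj[OF completion_ip_tendsto[OF r]]
      unfolding gram_cnj[symmetric] by (rule LIMSEQ_unique)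
  qed
  show "0 \<le> Re (completion_ip f f)" if "f \<in> completion" for f
  proof -
    from that obtain a where r: "represents a f" unfolding completion_def by blast
    show ?thesis
      by (rule tendsto_lowerbound[OF tendsto_Re[OF completion_ip_tendsto[OF r r]]])
         (auto simp: gram_nonneg)
  qed
  show "f = (\<lambda>x. 0)" if "f \<in> completion" "completion_ip f f = 0" for f
  proof
    fix t
    from that obtain a where r: "represents a f" unfolding completion_def by blast
    have "(\<lambda>n. rep_norm (a n)) \<longlonglongrightarrow> 0" using completion_norm_tendsto[OF r] that by simp
    hence "(\<lambda>n. rep_norm (a n) * rep_norm [(1, t)]) \<longlonglongrightarrow> 0" by (rule tendsto_mult_left_zero)
    hence "(\<lambda>n. G (a n) [(1, t)]) \<longlonglongrightarrow> 0"
      by (rule Lim_null_comparison[rotated]) (simp add: gram_cauchy_schwarz)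
    thus "f t = 0" using r LIMSEQ_unique unfolding represents_def by blast
  qed
  show "\<exists>f\<in>completion. (\<lambda>k. sqrt (Re (completion_ip (\<lambda>x. F k x - f x) (\<lambda>x. F k x - f x)))) \<longlonglongrightarrow> 0"
    if "\<And>k. F k \<in> completion"
      "\<And>e. 0 < e \<Longrightarrow> \<exists>M. \<forall>k\<ge>M. \<forall>l\<ge>M.
        sqrt (Re (completion_ip (\<lambda>x. F k x - F l x) (\<lambda>x. F k x - F l x))) < e" for F
    using that by (rule completion_complete)
  show "K t \<in> completion" for t
    unfolding completion_def using represents_kernel by blast
  show "f t = completion_ip f (K t)" if "f \<in> completion" for f t
  proof -
    from that obtain a where r: "represents a f" unfolding completion_def by blast
    show ?thesis
      using completion_ip_tendsto[OF r represents_kernel[of t]] r LIMSEQ_unique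
      unfolding represents_def by blast
  qed
qed

text \<open>
  The function \<open>rkhs\<close> selects some reproducing kernel Hilbert space; existence turns the selection
  into a space with the required properties.
\<close>
lemma rkhs_is_reproducing:
  "reproducing_kernel_hilbert_space (fst (rkhs K)) (snd (rkhs K)) K"
proof -
  have "case rkhs K of (H, ip) \<Rightarrow> reproducing_kernel_hilbert_space H ip K"
    unfolding rkhs_def by (rule someI[of _ "(completion, completion_ip)"]) (simp add: moore_aronszajn)
  thus ?thesis by (simp add: case_prod_beta)
qed

end

section \<open>Orthogonal residuals\<close>

context function_hilbert_space
begin

lemma diff_mem: "f \<in> H \<Longrightarrow> g \<in> H \<Longrightarrow> (\<lambda>x. f x - g x) \<in> H"
  using add_mem[of f "\<lambda>x. (-1) * g x"] scale_mem[of g "-1"] by simp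

lemma ip_diff: "f \<in> H \<Longrightarrow> g \<in> H \<Longrightarrow> h \<in> H \<Longrightarrow> ip (\<lambda>x. f x - g x) h = ip f h - ip g h"
  using ip_add[of f "\<lambda>x. (-1) * g x" h] scale_mem[of g "-1"] ip_scale[of g h "-1"] by simp

lemma ip_zero: "h \<in> H \<Longrightarrow> ip (\<lambda>x. 0) h = 0"
  using ip_scale[of h h 0] by simp

lemma sum_mem: "finite J \<Longrightarrow> (\<And>j. j \<in> J \<Longrightarrow> w j \<in> H) \<Longrightarrow> (\<lambda>x. \<Sum>j\<in>J. c j * w j x) \<in> H"
proof (induction J rule: finite_induct)
  case (insert k J)
  thus ?case using add_mem[OF scale_mem[of "w k" "c k"], of "\<lambda>x. \<Sum>j\<in>J. c j * w j x"] by simp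
qed (simp add: zero_mem)

lemma ip_sum_left:
  assumes "finite J" "\<And>j. j \<in> J \<Longrightarrow> w j \<in> H" "h \<in> H"
  shows "ip (\<lambda>x. \<Sum>j\<in>J. c j * w j x) h = (\<Sum>j\<in>J. c j * ip (w j) h)"
  using assms
proof (induction J rule: finite_induct)
  case (insert k J)
  thus ?case
    using ip_add[OF scale_mem[of "w k" "c k"] sum_mem[of J w c], of h] by (simp add: ip_scale)
qed (simp add: ip_zero)

lemma ip_diff_sum_right:
  assumes "finite J" "\<And>j. j \<in> J \<Longrightarrow> w j \<in> H" "h \<in> H" "v \<in> H"
  shows "ip h (\<lambda>x. v x - (\<Sum>j\<in>J. c j * w j x)) = ip h v - (\<Sum>j\<in>J. cnj (c j) * ip h (w j))"
proof -
  have S: "(\<lambda>x. \<Sum>j\<in>J. c j * w j x) \<in> H" using assms by (intro sum_mem)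
  have "ip h (\<lambda>x. v x - (\<Sum>j\<in>J. c j * w j x)) = cnj (ip (\<lambda>x. v x - (\<Sum>j\<in>J. c j * w j x)) h)"
    using assms S by (intro ip_cnj diff_mem)
  also have "\<dots> = cnj (ip v h) - (\<Sum>j\<in>J. cnj (c j) * cnj (ip (w j) h))"
    using assms S by (simp add: ip_diff ip_sum_left)
  also have "\<dots> = ip h v - (\<Sum>j\<in>J. cnj (c j) * ip h (w j))"
    using assms by (simp add: ip_cnj[of _ h])
  finally show ?thesis .
qed

text \<open>
  Gram-Schmidt with possibly dependent vectors \<open>w j\<close>. In the induction step both \<open>v\<close> and the new
  vector \<open>w k\<close> are replaced by their residuals \<open>f\<close> and \<open>g\<close> with respect to the old vectors; if \<open>g = 0\<close>,
  the new vector adds nothing, otherwise the component of \<open>f\<close> along \<open>g\<close> is subtracted.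
\<close>
lemma orthogonal_residual_exists:
  assumes "finite J" "\<And>j. j \<in> J \<Longrightarrow> w j \<in> H" "v \<in> H"
  shows "\<exists>c. \<forall>i\<in>J. ip (\<lambda>x. v x - (\<Sum>j\<in>J. c j * w j x)) (w i) = 0"
  using assms
proof (induction J arbitrary: v rule: finite_induct)
  case (insert k J)
  have wJ: "\<And>j. j \<in> J \<Longrightarrow> w j \<in> H" and wk: "w k \<in> H" using insert by auto
  obtain c where c: "\<forall>i\<in>J. ip (\<lambda>x. v x - (\<Sum>j\<in>J. c j * w j x)) (w i) = 0"
    using insert.IH[OF wJ \<open>v \<in> H\<close>] by blast
  obtain d where d: "\<forall>i\<in>J. ip (\<lambda>x. w k x - (\<Sum>j\<in>J. d j * w j x)) (w i) = 0"
    using insert.IH[OF wJ wk] by blast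
  define f g where "f x = v x - (\<Sum>j\<in>J. c j * w j x)" and "g x = w k x - (\<Sum>j\<in>J. d j * w j x)" for x
  have fH: "f \<in> H" and gH: "g \<in> H"
    unfolding f_def[abs_def] g_def[abs_def] using insert by (auto intro!: diff_mem sum_mem)
  have f0: "ip f (w i) = 0" and g0: "ip g (w i) = 0" if "i \<in> J" for i
    using c d that by (simp_all add: f_def[abs_def] g_def[abs_def])
  \<comment> \<open>On the orthogonal complement of the old vectors, \<open>w k\<close> and \<open>g\<close> have the same inner products.\<close>
  have g_wk: "ip h (w k) = ip h g" if "h \<in> H" "\<And>i. i \<in> J \<Longrightarrow> ip h (w i) = 0" for h
    using ip_diff_sum_right[of J w h "w k" d] that insert wJ wk by (simp add: g_def[abs_def])
  define \<alpha> where "\<alpha> = (if ip g g = 0 then 0 else ip f g / ip g g)"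
  have \<alpha>: "ip f g = \<alpha> * ip g g"
  proof (cases "ip g g = 0")
    case True
    hence "g = (\<lambda>x. 0)" using gH by (intro ip_definite)
    moreover have "ip f (\<lambda>x. 0) = 0"
      using ip_cnj[OF zero_mem fH] ip_zero[OF fH] by simp
    ultimately show ?thesis using True by simp
  qed (simp add: \<alpha>_def)
  define c' where "c' j = (if j = k then \<alpha> else c j - \<alpha> * d j)" for j
  have "(\<Sum>j\<in>J. c' j * w j x) = (\<Sum>j\<in>J. c j * w j x) - \<alpha> * (\<Sum>j\<in>J. d j * w j x)" for x
    unfolding sum_distrib_left sum_subtractf[symmetric]
    using \<open>k \<notin> J\<close> by (intro sum.cong) (auto simp: c'_def algebra_simps)
  hence eq: "(\<lambda>x. v x - (\<Sum>j\<in>insert k J. c' j * w j x)) = (\<lambda>x. f x - \<alpha> * g x)"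
    using insert by (auto simp: f_def g_def c'_def algebra_simps)
  have ip': "ip (\<lambda>x. f x - \<alpha> * g x) h = ip f h - \<alpha> * ip g h" if "h \<in> H" for h
    using ip_diff[OF fH scale_mem[OF gH] that] ip_scale[OF gH that] by simp
  have "ip (\<lambda>x. f x - \<alpha> * g x) (w i) = 0" if "i \<in> insert k J" for i
  proof (cases "i = k")
    case True
    thus ?thesis using g_wk[OF fH f0] g_wk[OF gH g0] \<alpha> by (simp add: ip'[OF wk])
  next
    case False
    thus ?thesis using that f0 g0 wJ by (simp add: ip')
  qed
  thus ?case unfolding eq[symmetric] by blast
qed simp

end

text \<open>
  By the reproducing property, orthogonality to \<open>K (p j)\<close> means vanishing at \<open>p j\<close>. The identity
  \<open>ip f f = f t\<close> holds because \<open>f\<close> is the projection of \<open>K t\<close> onto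
  the orthogonal complement of the \<open>K (p j)\<close>; it makes \<open>f\<close>, up to normalisation, the
  extremal function for point evaluation at \<open>t\<close> among those that vanish at the points \<open>p j\<close>.
\<close>
lemma (in reproducing_kernel_hilbert_space) kernel_residual_exists:
  fixes p :: "'i \<Rightarrow> 'x"
  assumes J: "finite J"
  obtains c f where "f = (\<lambda>x. K t x - (\<Sum>j\<in>J. c j * K (p j) x))" "f \<in> H"
    "\<forall>j\<in>J. f (p j) = 0" "ip f f = f t"
proof -
  obtain c where c: "\<forall>i\<in>J. ip (\<lambda>x. K t x - (\<Sum>j\<in>J. c j * K (p j) x)) (K (p i)) = 0"
    using orthogonal_residual_exists[OF J, of "\<lambda>j. K (p j)" "K t"] kernel_mem by blast
  define f where "f = (\<lambda>x. K t x - (\<Sum>j\<in>J. c j * K (p j) x))"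
  have fH: "f \<in> H" unfolding f_def by (intro diff_mem sum_mem J kernel_mem)
  have f0: "f (p j) = 0" if "j \<in> J" for j
    using c that reproducing[OF fH, of "p j"] by (simp add: f_def)
  have "ip f f = ip f (K t) - (\<Sum>j\<in>J. cnj (c j) * ip f (K (p j)))"
    using ip_diff_sum_right[OF J, of "\<lambda>j. K (p j)" f "K t" c] fH kernel_mem by (simp add: f_def)
  hence "ip f f = f t" using f0 by (simp add: reproducing[OF fH, symmetric])
  with that f_def fH f0 show ?thesis by blast
qed

section \<open>Functions vanishing at the sample points\<close>

text \<open>
  The two error functions differ by \<open>2 * f\<close>, so \<open>norm (f x) \<le> E\<close> for almost all \<open>x\<close>; a continuous
  function cannot exceed an almost everywhere bound at an interior point.
\<close>
lemma continuous_bound_of_ess_bounds: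
  fixes f g :: "real \<Rightarrow> complex"
  assumes f: "continuous_on UNIV f" and t: "0 < t" "t < 1"
    and E: "Linf_norm (\<lambda>x. f x - g x) \<le> E" "Linf_norm (\<lambda>x. - f x - g x) \<le> E"
  shows "ereal (norm (f t)) \<le> E"
proof (rule ccontr)
  assume "\<not> ereal (norm (f t)) \<le> E"
  hence "E < ereal (norm (f t))" by simp
  then obtain r where r: "E < ereal r" "r < norm (f t)"
    using ereal_dense2 by fastforce
  have ae: "AE x in lebesgue_on {0..1}. ereal (norm (f x - g x)) \<le> E \<and> ereal (norm (- f x - g x)) \<le> E"
    using esssup_AE[of "\<lambda>x. ereal (norm (f x - g x))" "lebesgue_on {0..1}"]
      esssup_AE[of "\<lambda>x. ereal (norm (- f x - g x))" "lebesgue_on {0..1}"]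
    by eventually_elim (use E in \<open>auto simp: Linf_norm_def intro: order_trans\<close>)
  have "AE x in lebesgue_on {0..1}. norm (f x) \<le> r"
    using ae
  proof eventually_elim
    case (elim x)
    hence "ereal (norm (f x - g x)) < ereal r" "ereal (norm (- f x - g x)) < ereal r"
      by (blast intro: le_less_trans[OF _ r(1)])+
    hence "norm (f x - g x) < r" "norm (- f x - g x) < r" by auto
    moreover have "norm ((f x - g x) - (- f x - g x)) \<le> norm (f x - g x) + norm (- f x - g x)"
      by (rule norm_triangle_ineq4)
    moreover have "norm ((f x - g x) - (- f x - g x)) = 2 * norm (f x)"
      by (simp add: norm_mult flip: mult_2)
    ultimately show ?case by simp
  qed
  hence "AE x in lebesgue. x \<in> {0..1} \<longrightarrow> norm (f x) \<le> r"
    by (subst (asm) AE_restrict_space_iff) auto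
  hence ae': "AE x\<in>{0<..<1} in lebesgue. x \<in> {x. norm (f x) \<le> r}"
    by eventually_elim auto
  have cl: "closed {x. norm (f x) \<le> r}"
    by (intro closed_Collect_le continuous_on_norm f continuous_on_const)
  have "t \<in> {x. norm (f x) \<le> r}"
    using mem_closed_if_AE_lebesgue_open[OF open_greaterThanLessThan cl ae', of t] t by simp
  thus False using r by simp
qed

text \<open>
  A reconstruction map cannot distinguish \<open>f\<close> from \<open>- f\<close>, because all samples of both are zero.
\<close>
lemma min_reconstruction_error_ge:
  assumes f: "f \<in> rkhs_unit_ball K" "(\<lambda>x. - f x) \<in> rkhs_unit_ball K"
    and cont: "continuous_on UNIV f"
    and zero: "\<And>j. j \<in> sample_points n \<Longrightarrow> f (of_int j) = 0"
    and t: "0 < t" "t < 1"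
  shows "ereal (norm (f t)) \<le> min_reconstruction_error n K"
  unfolding min_reconstruction_error_def
proof (rule INF_greatest)
  fix A
  define z :: "int \<Rightarrow> complex" where "z = restrict (\<lambda>_. 0) (sample_points n)"
  have z: "samples n f = z" "samples n (\<lambda>x. - f x) = z"
    using zero by (auto simp: samples_def z_def restrict_def)
  have "Linf_norm (\<lambda>x. h x - A z x) \<le> reconstruction_error n A K"
    if "h \<in> rkhs_unit_ball K" "samples n h = z" for h
    unfolding reconstruction_error_def using that(1) by (rule SUP_upper2) (simp add: that(2))
  with f z show "ereal (norm (f t)) \<le> reconstruction_error n A K"
    by (intro continuous_bound_of_ess_bounds[OF cont t, of "A z"]) auto
qed

section \<open>Kernels with a spectral density\<close>

definition spectral_kernel :: "real \<Rightarrow> (real \<Rightarrow> real) \<Rightarrow> real \<Rightarrow> real \<Rightarrow> complex" where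
  "spectral_kernel \<delta> \<rho> t \<tau> = (LINT \<xi>|lebesgue_on {-\<delta>..\<delta>}. cis ((t - \<tau>) * \<xi>) * of_real (\<rho> \<xi>))"

locale spectral_density =
  fixes \<delta> :: real and \<rho> :: "real \<Rightarrow> real"
  assumes density_integrable: "integrable (lebesgue_on {-\<delta>..\<delta>}) \<rho>"
    and density_nonneg: "AE \<xi> in lebesgue_on {-\<delta>..\<delta>}. 0 \<le> \<rho> \<xi>"
begin

abbreviation "\<mu> \<equiv> lebesgue_on {-\<delta>..\<delta>}"

lemma integrable_times_density:
  fixes g :: "real \<Rightarrow> complex"
  assumes g: "continuous_on {-\<delta>..\<delta>} g"
  shows "integrable \<mu> (\<lambda>\<xi>. g \<xi> * of_real (\<rho> \<xi>))"
proof -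
  have "bounded (g ` {-\<delta>..\<delta>})"
    by (intro compact_imp_bounded compact_continuous_image g compact_Icc)
  then obtain B where B: "\<And>x. x \<in> {-\<delta>..\<delta>} \<Longrightarrow> norm (g x) \<le> B"
    unfolding bounded_iff by blast
  show ?thesis
  proof (rule Bochner_Integration.integrable_bound)
    show "integrable \<mu> (\<lambda>\<xi>. B * \<rho> \<xi>)" using density_integrable by simp
    have "g \<in> borel_measurable \<mu>"
      by (intro continuous_imp_measurable_on_sets_lebesgue g) simp
    thus "(\<lambda>\<xi>. g \<xi> * of_real (\<rho> \<xi>)) \<in> borel_measurable \<mu>"
      using borel_measurable_integrable[OF density_integrable] by (intro borel_measurable_times measurable_compose[OF _ borel_measurable_of_real])
    show "AE \<xi> in \<mu>. norm (g \<xi> * of_real (\<rho> \<xi>)) \<le> norm (B * \<rho> \<xi>)"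
    proof (rule AE_I2)
      fix x assume "x \<in> space \<mu>"
      hence "norm (g x) \<le> \<bar>B\<bar>" using B[of x] by (simp add: space_restrict_space)
      thus "norm (g x * of_real (\<rho> x)) \<le> norm (B * \<rho> x)"
        by (simp add: norm_mult abs_mult mult_right_mono)
    qed
  qed
qed

lemma spectral_kernel_has_integral:
  "has_bochner_integral \<mu> (\<lambda>\<xi>. cis ((t - \<tau>) * \<xi>) * of_real (\<rho> \<xi>)) (spectral_kernel \<delta> \<rho> t \<tau>)"
  unfolding spectral_kernel_def cis_conv_exp
  by (intro has_bochner_integral_integrable integrable_times_density continuous_intros)

lemma gram_spectral_kernel:
  "has_bochner_integral \<mu> (\<lambda>\<xi>. (\<Sum>(c, s)\<leftarrow>xs. c * cis (s * \<xi>)) * cnj (\<Sum>(d, t)\<leftarrow>ys. d * cis (t * \<xi>)) * of_real (\<rho> \<xi>))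
    (gram (spectral_kernel \<delta> \<rho>) xs ys)"
proof (induction xs)
  case (Cons p xs)
  obtain c s where p: "p = (c, s)" by (cases p)
  have "has_bochner_integral \<mu> (\<lambda>\<xi>. c * cis (s * \<xi>) * cnj (\<Sum>(d, t)\<leftarrow>ys. d * cis (t * \<xi>)) * of_real (\<rho> \<xi>))
    (\<Sum>(d, t)\<leftarrow>ys. c * cnj d * spectral_kernel \<delta> \<rho> s t)"
  proof (induction ys)
    case (Cons q ys)
    obtain d t where q: "q = (d, t)" by (cases q)
    have "cis ((s - t) * \<xi>) = cis (s * \<xi>) * cnj (cis (t * \<xi>))" for \<xi>
      by (simp add: cis_cnj cis_mult algebra_simps)
    hence "has_bochner_integral \<mu> (\<lambda>\<xi>. c * cnj d * (cis (s * \<xi>) * cnj (cis (t * \<xi>)) * of_real (\<rho> \<xi>)))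
        (c * cnj d * spectral_kernel \<delta> \<rho> s t)"
      using spectral_kernel_has_integral[of s t] by (intro has_bochner_integral_mult_right) simp
    from has_bochner_integral_add[OF this Cons] show ?case
      by (simp add: q algebra_simps)
  qed (simp add: has_bochner_integral_zero)
  from has_bochner_integral_add[OF this Cons] show ?case
    by (simp add: p gram_def algebra_simps)
qed (simp add: gram_def has_bochner_integral_zero)

text \<open>
  The integrand is real and almost everywhere nonnegative; the imaginary part is recorded as well,
  since an inner product \<open>ip f f\<close> will be identified with such an integral.
\<close>
lemma Re_integral_nonneg:
  fixes P :: "real \<Rightarrow> complex"
  assumes "has_bochner_integral \<mu> (\<lambda>\<xi>. P \<xi> * cnj (P \<xi>) * of_real (\<rho> \<xi>)) z"
  shows "has_bochner_integral \<mu> (\<lambda>\<xi>. (norm (P \<xi>))\<^sup>2 * \<rho> \<xi>) (Re z)" "0 \<le> Re z" "Im z = 0"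
proof -
  have eq: "P \<xi> * cnj (P \<xi>) * of_real (\<rho> \<xi>) = of_real ((norm (P \<xi>))\<^sup>2 * \<rho> \<xi>)" for \<xi>
    by (simp only: complex_norm_square[symmetric]) simp
  show 1: "has_bochner_integral \<mu> (\<lambda>\<xi>. (norm (P \<xi>))\<^sup>2 * \<rho> \<xi>) (Re z)"
    using has_bochner_integral_bounded_linear[OF bounded_linear_Re assms] unfolding eq by simp
  have "has_bochner_integral \<mu> (\<lambda>\<xi>. 0::real) (Im z)"
    using has_bochner_integral_bounded_linear[OF bounded_linear_Im assms] unfolding eq by simp
  thus "Im z = 0" by (simp add: has_bochner_integral_iff)
  have "0 \<le> integral\<^sup>L \<mu> (\<lambda>\<xi>. (norm (P \<xi>))\<^sup>2 * \<rho> \<xi>)"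
    using density_nonneg by (intro integral_nonneg_AE) (auto elim: eventually_mono)
  thus "0 \<le> Re z" using 1 by (simp add: has_bochner_integral_iff)
qed

sublocale positive_definite_kernel "spectral_kernel \<delta> \<rho>"
proof
  show "spectral_kernel \<delta> \<rho> t s = cnj (spectral_kernel \<delta> \<rho> s t)" for s t
  proof -
    have "cnj (spectral_kernel \<delta> \<rho> s t)
        = (LINT \<xi>|\<mu>. cnj (cis ((s - t) * \<xi>) * of_real (\<rho> \<xi>)))"
      unfolding spectral_kernel_def by (rule Bochner_Integration.integral_cnj[symmetric])
    also have "\<dots> = spectral_kernel \<delta> \<rho> t s"
      unfolding spectral_kernel_def by (simp add: cis_cnj algebra_simps)
    finally show ?thesis by simp
  qed
  show "0 \<le> Re (gram (spectral_kernel \<delta> \<rho>) xs xs)" for xs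
    using Re_integral_nonneg(2)[OF gram_spectral_kernel[of xs xs]] .
qed

text \<open>
  Since \<open>f\<close> vanishes at the points \<open>p j\<close>, subtracting \<open>cnj (c j) * f (p j)\<close> from \<open>f t\<close> changes nothing,
  but completes the factor \<open>cnj (cis (t * \<xi>))\<close> of the spectral integral to \<open>cnj (P \<xi>)\<close>.
\<close>
lemma kernel_residual_value:
  fixes p :: "'i \<Rightarrow> real"
  assumes f: "f = (\<lambda>x. spectral_kernel \<delta> \<rho> t x - (\<Sum>j\<in>J. c j * spectral_kernel \<delta> \<rho> (p j) x))"
    and f0: "\<And>j. j \<in> J \<Longrightarrow> f (p j) = 0"
  defines "P \<equiv> (\<lambda>\<xi>. cis (t * \<xi>) - (\<Sum>j\<in>J. c j * cis (p j * \<xi>)))"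
  shows "has_bochner_integral \<mu> (\<lambda>\<xi>. (norm (P \<xi>))\<^sup>2 * \<rho> \<xi>) (Re (f t))" "Im (f t) = 0"
proof -
  have shift: "cis ((s - x) * \<xi>) = cis (s * \<xi>) * cnj (cis (x * \<xi>))" for s x \<xi> :: real
    by (simp add: cis_cnj cis_mult algebra_simps)
  have fx: "has_bochner_integral \<mu> (\<lambda>\<xi>. P \<xi> * cnj (cis (x * \<xi>)) * of_real (\<rho> \<xi>)) (f x)" for x
  proof -
    have "has_bochner_integral \<mu> (\<lambda>\<xi>. cis ((t - x) * \<xi>) * of_real (\<rho> \<xi>)
        - (\<Sum>j\<in>J. c j * (cis ((p j - x) * \<xi>) * of_real (\<rho> \<xi>)))) (f x)"
      unfolding f
      by (intro has_bochner_integral_diff has_bochner_integral_sum has_bochner_integral_mult_right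
          spectral_kernel_has_integral)
    moreover have "cis ((t - x) * \<xi>) * of_real (\<rho> \<xi>)
        - (\<Sum>j\<in>J. c j * (cis ((p j - x) * \<xi>) * of_real (\<rho> \<xi>)))
        = P \<xi> * cnj (cis (x * \<xi>)) * of_real (\<rho> \<xi>)" for \<xi>
      unfolding shift P_def by (simp only: left_diff_distrib right_diff_distrib sum_distrib_left sum_distrib_right mult_ac)
    ultimately show ?thesis by simp
  qed
  have cnj_P: "cnj (P \<xi>) = cnj (cis (t * \<xi>)) - (\<Sum>j\<in>J. cnj (c j) * cnj (cis (p j * \<xi>)))" for \<xi>
    by (simp only: P_def complex_cnj_diff cnj_sum complex_cnj_mult)
  have "has_bochner_integral \<mu> (\<lambda>\<xi>. P \<xi> * cnj (cis (t * \<xi>)) * of_real (\<rho> \<xi>)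
        - (\<Sum>j\<in>J. cnj (c j) * (P \<xi> * cnj (cis (p j * \<xi>)) * of_real (\<rho> \<xi>))))
      (f t - (\<Sum>j\<in>J. cnj (c j) * f (p j)))"
    by (intro has_bochner_integral_diff has_bochner_integral_sum has_bochner_integral_mult_right fx)
  moreover have "P \<xi> * cnj (cis (t * \<xi>)) * of_real (\<rho> \<xi>)
        - (\<Sum>j\<in>J. cnj (c j) * (P \<xi> * cnj (cis (p j * \<xi>)) * of_real (\<rho> \<xi>)))
      = P \<xi> * cnj (P \<xi>) * of_real (\<rho> \<xi>)" for \<xi>
    unfolding cnj_P
    by (simp only: right_diff_distrib left_diff_distrib sum_distrib_left sum_distrib_right mult_ac)
  ultimately have "has_bochner_integral \<mu> (\<lambda>\<xi>. P \<xi> * cnj (P \<xi>) * of_real (\<rho> \<xi>)) (f t)"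
    using f0 by simp
  from Re_integral_nonneg[OF this]
  show "has_bochner_integral \<mu> (\<lambda>\<xi>. (norm (P \<xi>))\<^sup>2 * \<rho> \<xi>) (Re (f t))" "Im (f t) = 0" by auto
qed

lemma weighted_integral_ge:
  fixes P :: "real \<Rightarrow> complex"
  assumes int: "has_bochner_integral \<mu> (\<lambda>\<xi>. (norm (P \<xi>))\<^sup>2 * \<rho> \<xi>) I"
    and P: "continuous_on {a..b} P" and ab: "{a..b} \<subseteq> {-\<delta>..\<delta>}"
    and m: "AE \<xi> in lebesgue_on {a..b}. m \<le> \<rho> \<xi>"
  shows "m * integral {a..b} (\<lambda>\<xi>. (norm (P \<xi>))\<^sup>2) \<le> I"
proof -
  let ?g = "\<lambda>\<xi>. m * (norm (P \<xi>))\<^sup>2"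
  have g: "integrable (lebesgue_on {a..b}) ?g"
    by (intro continuous_imp_integrable_real continuous_intros P)
  have "m * integral {a..b} (\<lambda>\<xi>. (norm (P \<xi>))\<^sup>2) = integral {a..b} ?g" by simp
  also have "\<dots> = integral\<^sup>L (lebesgue_on {a..b}) ?g"
    using g by (intro lebesgue_integral_eq_integral[symmetric]) auto
  also have "\<dots> \<le> integral\<^sup>L (lebesgue_on {a..b}) (\<lambda>\<xi>. (norm (P \<xi>))\<^sup>2 * \<rho> \<xi>)"
  proof (rule integral_mono_AE[OF g])
    show "integrable (lebesgue_on {a..b}) (\<lambda>\<xi>. (norm (P \<xi>))\<^sup>2 * \<rho> \<xi>)"
      using int ab unfolding has_bochner_integral_iff by (blast intro: integrable_subinterval)
    show "AE \<xi> in lebesgue_on {a..b}. ?g \<xi> \<le> (norm (P \<xi>))\<^sup>2 * \<rho> \<xi>"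
      using m by eventually_elim (subst mult.commute, rule mult_left_mono, auto)
  qed
  also have "\<dots> = integral\<^sup>L \<mu> (\<lambda>\<xi>. if \<xi> \<in> {a..b} then (norm (P \<xi>))\<^sup>2 * \<rho> \<xi> else 0)"
    using ab by (intro integral_restrict[symmetric]) auto
  also have "\<dots> \<le> integral\<^sup>L \<mu> (\<lambda>\<xi>. (norm (P \<xi>))\<^sup>2 * \<rho> \<xi>)"
  proof (rule integral_mono_AE')
    show "integrable \<mu> (\<lambda>\<xi>. (norm (P \<xi>))\<^sup>2 * \<rho> \<xi>)"
      using int by (simp add: has_bochner_integral_iff)
    show "AE \<xi> in \<mu>. (if \<xi> \<in> {a..b} then (norm (P \<xi>))\<^sup>2 * \<rho> \<xi> else 0) \<le> (norm (P \<xi>))\<^sup>2 * \<rho> \<xi>"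
      using density_nonneg by eventually_elim auto
    show "AE \<xi> in \<mu>. 0 \<le> (norm (P \<xi>))\<^sup>2 * \<rho> \<xi>"
      using density_nonneg by eventually_elim auto
  qed
  also have "\<dots> = I" using int by (simp add: has_bochner_integral_iff)
  finally show ?thesis .
qed

end

section \<open>Fourier coefficients of an inverse chord length\<close>

text \<open>
  This is \<open>(2 * k choose k) / 4 ^ k\<close>, the coefficient of \<open>z ^ k\<close> in \<open>(1 - z) powr (-1/2)\<close>.
\<close>
definition central_coeff :: "nat \<Rightarrow> real" where
  "central_coeff k = (-1) ^ k * ((-1/2) gchoose k)"

lemma central_coeff_0 [simp]: "central_coeff 0 = 1"
  by (simp add: central_coeff_def)

lemma central_coeff_Suc:
  "central_coeff (Suc k) = central_coeff k * ((2 * real k + 1) / (2 * real k + 2))"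
proof -
  have "(-1/2::real) * ((-1/2) gchoose k)
      = real k * ((-1/2) gchoose k) + real (Suc k) * ((-1/2) gchoose Suc k)"
    using gbinomial_mult_1[of "-1/2::real" k] by simp
  hence "((-1/2::real) gchoose Suc k) * (2 * real k + 2) = - ((-1/2) gchoose k) * (2 * real k + 1)"
    by (simp add: algebra_simps)
  hence "((-1/2::real) gchoose Suc k) = - ((-1/2) gchoose k) * (2 * real k + 1) / (2 * real k + 2)"
    by (subst eq_divide_eq) auto
  thus ?thesis by (simp add: central_coeff_def)
qed

lemma central_coeff_pos: "0 < central_coeff k"
  by (induction k) (auto simp: central_coeff_Suc)

lemma central_coeff_Suc_less: "central_coeff (Suc k) < central_coeff k"
  using central_coeff_pos[of k] by (simp add: central_coeff_Suc field_simps)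

text \<open>
  The quantity \<open>4 * n * (central_coeff n)\<^sup>2\<close> is increasing in \<open>n\<close> and equals \<open>1\<close> at \<open>n = 1\<close>.
\<close>
lemma central_coeff_lower_bound:
  assumes "1 \<le> n" shows "1 / (2 * sqrt (real n)) \<le> central_coeff n"
proof -
  have "1 \<le> 4 * real n * (central_coeff n)\<^sup>2"
    using assms
  proof (induction n rule: dec_induct)
    case base
    show ?case by (simp add: central_coeff_Suc power2_eq_square)
  next
    case (step n)
    have "n * (2 * real n + 2)^2 \<le> real (Suc n) * (2 * real n + 1)^2"
      by (simp add: power2_eq_square algebra_simps)
    hence "real n \<le> real (Suc n) * ((2 * real n + 1) / (2 * real n + 2))\<^sup>2"
      by (simp add: power_divide field_simps)
    hence "4 * (central_coeff n)\<^sup>2 * real n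
        \<le> 4 * (central_coeff n)\<^sup>2 * (real (Suc n) * ((2 * real n + 1) / (2 * real n + 2))\<^sup>2)"
      by (intro mult_left_mono) auto
    with step show ?case
      by (simp only: central_coeff_Suc power_mult_distrib mult_ac)
  qed
  hence "(1 / (2 * sqrt (real n)))\<^sup>2 \<le> (central_coeff n)\<^sup>2"
    using assms by (simp add: power_divide power_mult_distrib field_simps)
  thus ?thesis
    using central_coeff_pos[of n] by (simp add: power2_le_iff_abs_le)
qed

text \<open>
  The partial sums are those of the binomial series of \<open>(1 + w) powr (-1/2)\<close>, whose squared modulus is
  \<open>1 / norm (1 + w)\<close>.
\<close>
lemma inverse_norm_one_plus_limit:
  fixes w :: complex
  assumes "norm w < 1"
  shows "(\<lambda>N. (norm (\<Sum>k<N. of_real (central_coeff k) * (- w) ^ k))\<^sup>2) \<longlonglongrightarrow> 1 / norm (1 + w)"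
proof -
  have eq: "(- (1/2) gchoose k) = complex_of_real (- (1/2) gchoose k)" for k
    by (simp add: gbinomial_prod_rev)
  have "(\<lambda>k. ((-1/2::complex) gchoose k) * w ^ k) sums (1 + w) powr (-1/2)"
    by (rule gen_binomial_complex[OF assms])
  moreover have "((-1/2::complex) gchoose k) * w ^ k = of_real (central_coeff k) * (- w) ^ k" for k
  proof -
    have "(-1) ^ k * (- w) ^ k = w ^ k" by (simp flip: power_mult_distrib)
    moreover have "of_real (central_coeff k) * (- w) ^ k
        = of_real ((-1/2) gchoose k) * ((-1) ^ k * (- w) ^ k)"
      by (simp add: central_coeff_def)
    ultimately show ?thesis by (simp add: eq)
  qed
  ultimately have "(\<lambda>k. of_real (central_coeff k) * (- w) ^ k) sums (1 + w) powr (-1/2)"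
    by simp
  hence "(\<lambda>N. \<Sum>k<N. of_real (central_coeff k) * (- w) ^ k) \<longlonglongrightarrow> (1 + w) powr (-1/2)"
    by (simp add: sums_def)
  hence lim: "(\<lambda>N. (norm (\<Sum>k<N. of_real (central_coeff k) * (- w) ^ k))\<^sup>2)
      \<longlonglongrightarrow> (norm ((1 + w) powr (-1/2)))\<^sup>2"
    by (intro tendsto_intros)
  have "1 + w \<noteq> 0"
    using assms by (metis add.inverse_inverse add_eq_0_iff norm_minus_cancel norm_one order_less_irrefl)
  have "(norm ((1 + w) powr (-1/2)))\<^sup>2 = (norm (1 + w) powr (-1/2))\<^sup>2"
    by (subst norm_powr_real_powr') auto
  also have "\<dots> = 1 / norm (1 + w)"
    using \<open>1 + w \<noteq> 0\<close> by (simp add: power2_eq_square flip: powr_add)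
  finally show ?thesis using lim by simp
qed

lemma has_integral_cos_even:
  fixes m :: int
  shows "((\<lambda>u. cos (2 * of_int m * u)) has_integral (if m = 0 then pi else 0)) {-(pi/2)..pi/2}"
proof (cases "m = 0")
  case True
  show ?thesis
    using has_integral_const_real[of "1::real" "-(pi/2)" "pi/2"] True by simp
next
  case False
  have "((\<lambda>u. cos (2 * of_int m * u)) has_integral
     (sin (2 * of_int m * (pi/2)) / (2 * of_int m) - sin (2 * of_int m * (-(pi/2))) / (2 * of_int m)))
      {-(pi/2)..pi/2}"
    using False
    by (intro fundamental_theorem_of_calculus)
       (auto intro!: derivative_eq_intros simp flip: has_real_derivative_iff_has_vector_derivative)
  moreover have "sin (of_int m * pi) = 0"
    using sin_int_times_real[of _ m] by (simp add: sin_zero_iff_int2)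
  ultimately show ?thesis using False by (simp add: field_simps)
qed

lemma cmod_square_cis_sum:
  fixes p :: "nat \<Rightarrow> real"
  shows "(norm (\<Sum>k<N. of_real (p k) * cis (real k * x)))\<^sup>2
     = (\<Sum>j<N. \<Sum>k<N. p j * p k * cos ((real j - real k) * x))"
proof -
  let ?S = "\<Sum>k<N. of_real (p k) * cis (real k * x)"
  have "complex_of_real ((norm ?S)\<^sup>2) = ?S * cnj ?S"
    by (rule complex_norm_square)
  also have "\<dots> = (\<Sum>j<N. \<Sum>k<N. of_real (p j * p k) * cis ((real j - real k) * x))"
    by (simp add: sum_product cnj_sum cis_cnj cis_mult algebra_simps)
  finally have "Re (complex_of_real ((norm ?S)\<^sup>2)) = Re \<dots>" by simp
  thus ?thesis by simp
qed

text \<open>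
  The Fourier coefficients of the squared modulus of a trigonometric polynomial are the
  autocorrelations of its coefficients. Extending \<open>p\<close> by zero beyond \<open>N\<close> avoids a restriction of the
  summation range.
\<close>
lemma has_integral_cmod_square_cis_sum:
  fixes p :: "nat \<Rightarrow> real"
  assumes "1 \<le> n" and p0: "\<And>k. N \<le> k \<Longrightarrow> p k = 0"
  shows "((\<lambda>u. (norm (\<Sum>k<N. of_real (p k) * cis (real k * (2 * u))))\<^sup>2 * cos (2 * real n * u))
     has_integral pi * (\<Sum>j<N. p j * p (j + n))) {-(pi/2)..pi/2}"
proof -
  have *: "((\<lambda>u. p j * p k / 2 * (cos (2 * of_int (int j - int k + int n) * u) + cos (2 * of_int (int j - int k - int n) * u)))
     has_integral p j * p k / 2 * ((if int j - int k + int n = 0 then pi else 0) + (if int j - int k - int n = 0 then pi else 0))) {-(pi/2)..pi/2}" for j k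
    by (intro has_integral_mult_right has_integral_add has_integral_cos_even)
  have **: "((\<lambda>u. \<Sum>j<N. \<Sum>k<N. p j * p k / 2 * (cos (2 * of_int (int j - int k + int n) * u) + cos (2 * of_int (int j - int k - int n) * u)))
     has_integral (\<Sum>j<N. \<Sum>k<N. p j * p k / 2 * ((if int j - int k + int n = 0 then pi else 0) + (if int j - int k - int n = 0 then pi else 0)))) {-(pi/2)..pi/2}"
    by (intro has_integral_sum * finite_lessThan)
  have A: "(\<Sum>k<N. p j * p k * (if k = j + n then pi else 0)) = pi * (p j * p (j + n))" for j
    by (cases "j + n < N") (auto simp: p0 if_distrib sum.delta cong: if_cong)
  have "(\<Sum>j<N. \<Sum>k<N. p j * p k / 2 * ((if int j - int k + int n = 0 then pi else 0) + (if int j - int k - int n = 0 then pi else 0)))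
     = (1/2) * ((\<Sum>j<N. \<Sum>k<N. p j * p k * (if k = j + n then pi else 0))
        + (\<Sum>j<N. \<Sum>k<N. p j * p k * (if j = k + n then pi else 0)))"
    unfolding sum_distrib_left sum.distrib[symmetric]
    by (intro sum.cong refl) (auto simp: algebra_simps)
  also have "(\<Sum>j<N. \<Sum>k<N. p j * p k * (if j = k + n then pi else 0))
      = (\<Sum>k<N. \<Sum>j<N. p k * p j * (if j = k + n then pi else 0))"
    by (subst sum.swap) (simp add: mult_ac)
  also have "(1/2) * ((\<Sum>j<N. \<Sum>k<N. p j * p k * (if k = j + n then pi else 0)) + \<dots>)
      = pi * (\<Sum>j<N. p j * p (j + n))"
    unfolding A by (simp add: sum_distrib_left)
  finally have val: "(\<Sum>j<N. \<Sum>k<N. p j * p k / 2 * ((if int j - int k + int n = 0 then pi else 0) + (if int j - int k - int n = 0 then pi else 0)))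
     = pi * (\<Sum>j<N. p j * p (j + n))" .
  have fn: "(\<Sum>j<N. \<Sum>k<N. p j * p k / 2 * (cos (2 * of_int (int j - int k + int n) * u) + cos (2 * of_int (int j - int k - int n) * u)))
      = (norm (\<Sum>k<N. of_real (p k) * cis (real k * (2 * u))))\<^sup>2 * cos (2 * real n * u)" for u
    unfolding cmod_square_cis_sum sum_distrib_right
  proof (intro sum.cong refl)
    fix j k
    show "p j * p k / 2 * (cos (2 * of_int (int j - int k + int n) * u) + cos (2 * of_int (int j - int k - int n) * u))
        = p j * p k * cos ((real j - real k) * (2 * u)) * cos (2 * real n * u)"
    proof -
      have "cos (2 * of_int (int j - int k + int n) * u) + cos (2 * of_int (int j - int k - int n) * u)
          = 2 * (cos ((real j - real k) * (2 * u)) * cos (2 * real n * u))"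
        using cos_times_cos[of "(real j - real k) * (2 * u)" "2 * real n * u"]
        by (simp add: algebra_simps)
      thus ?thesis by simp
    qed
  qed
  from ** show ?thesis unfolding fn val .
qed

text \<open>
  The difference of two consecutive autocorrelations of a decreasing nonnegative sequence is a sum of
  nonnegative terms, hence at least its term for \<open>j = 0\<close>.
\<close>
lemma truncated_antitone_correlation_lower_bound:
  fixes p :: "nat \<Rightarrow> real"
  assumes nonneg: "\<And>k. 0 \<le> p k" and anti: "\<And>k. p (Suc k) \<le> p k" and "1 \<le> N"
  shows "p 0 * (p n - p (Suc n)) \<le> (\<Sum>j<N. p j * p (j + n)) - (\<Sum>j<N. p j * p (j + Suc n))"
proof -
  have "(\<Sum>j<N. p j * p (j + n)) - (\<Sum>j<N. p j * p (j + Suc n))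
      = (\<Sum>j<N. p j * (p (j + n) - p (Suc (j + n))))"
    by (simp add: sum_subtractf right_diff_distrib)
  moreover have "p 0 * (p (0 + n) - p (Suc (0 + n))) \<le> \<dots>"
    using assms by (intro member_le_sum[where i = 0]) (auto intro!: mult_nonneg_nonneg)
  ultimately show ?thesis by simp
qed

text \<open>
  The sum of two cosines of consecutive frequencies produces the difference of two consecutive
  autocorrelations of \<open>central_coeff k * q ^ k\<close>: the signs of the binomial series of
  \<open>(1 + z) powr (-1/2)\<close> contribute a factor \<open>(-1) ^ n\<close> to the coefficient of frequency \<open>2 * n\<close>, and thus
  opposite signs to the two cosines. The bound for the truncated series passes to the limit by
  dominated convergence.
\<close>
lemma inverse_norm_fourier_lower_bound:
  fixes q :: real
  assumes q: "0 \<le> q" "q < 1" and "1 \<le> n"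
  defines "c \<equiv> (\<lambda>u. norm (1 + of_real q * cis (2 * u)))"
  shows "pi * (central_coeff n * q ^ n * (1 - q + q / (2 * real n + 2)))
     \<le> (-1) ^ n * integral {-(pi/2)..pi/2} (\<lambda>u. (cos (2 * real n * u) + cos (2 * real (Suc n) * u)) / c u)"
proof -
  define P where "P N k = (if k < N then central_coeff k * q ^ k else 0)" for N k :: nat
  define T where "T N u = (norm (\<Sum>k<N. of_real ((-1) ^ k * P N k) * cis (real k * (2 * u))))\<^sup>2" for N u
  define F where "F u = (cos (2 * real n * u) + cos (2 * real (Suc n) * u))" for u
  have c_pos: "1 - q \<le> c u" for u
  proof -
    have "norm (1::complex) - norm (of_real q * cis (2 * u)) \<le> c u"
      unfolding c_def by (rule norm_diff_ineq)
    thus ?thesis using q by (simp add: norm_mult)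
  qed
  have T_eq: "T N u = (norm (\<Sum>k<N. of_real (central_coeff k) * (- (of_real q * cis (2 * u))) ^ k))\<^sup>2" for N u
    unfolding T_def
    by (intro arg_cong[where f = "\<lambda>x. (norm x)\<^sup>2"] sum.cong)
       (auto simp: P_def power_mult_distrib Complex.DeMoivre power_minus[of "_ * _"])
  have T_lim: "(\<lambda>N. T N u) \<longlonglongrightarrow> 1 / c u" for u
    unfolding T_eq c_def using q by (intro inverse_norm_one_plus_limit) (simp add: norm_mult)
  have T_bound: "T N u \<le> (1 / (1 - q))\<^sup>2" for N u
  proof -
    have "norm (\<Sum>k<N. of_real (central_coeff k) * (- (of_real q * cis (2 * u))) ^ k)
        \<le> (\<Sum>k<N. q ^ k)"
    proof (intro sum_norm_le)
      fix k
      have "central_coeff k \<le> central_coeff 0"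
        by (rule lift_Suc_antimono_le) (auto intro: less_imp_le central_coeff_Suc_less)
      thus "norm (of_real (central_coeff k) * (- (of_real q * cis (2 * u))) ^ k) \<le> q ^ k"
        using q central_coeff_pos[of k] by (simp add: norm_mult norm_power mult_left_le_one_le)
    qed
    also have "\<dots> \<le> (\<Sum>k. q ^ k)"
      using q by (intro sum_le_suminf summable_geometric) auto
    also have "\<dots> = 1 / (1 - q)" using q by (simp add: suminf_geometric)
    finally show ?thesis unfolding T_eq by (intro power_mono) auto
  qed
  have int: "((\<lambda>u. T N u * F u) has_integral
      pi * ((\<Sum>j<N. ((-1) ^ j * P N j) * ((-1) ^ (j + n) * P N (j + n)))
          + (\<Sum>j<N. ((-1) ^ j * P N j) * ((-1) ^ (j + Suc n) * P N (j + Suc n))))) {-(pi/2)..pi/2}" for N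
    unfolding F_def ring_distribs T_def using \<open>1 \<le> n\<close>
    by (intro has_integral_add has_integral_cmod_square_cis_sum) (auto simp: P_def)
  have int_ge: "pi * (P N 0 * (P N n - P N (Suc n)))
      \<le> (-1) ^ n * integral {-(pi/2)..pi/2} (\<lambda>u. T N u * F u)" if "1 \<le> N" for N
  proof -
    have sgn: "(\<Sum>j<N. ((-1) ^ j * P N j) * ((-1) ^ (j + m) * P N (j + m)))
        = (-1) ^ m * (\<Sum>j<N. P N j * P N (j + m))" for m
      unfolding sum_distrib_left by (intro sum.cong refl) (simp add: power_add mult_ac)
    have "(-1) ^ n * integral {-(pi/2)..pi/2} (\<lambda>u. T N u * F u)
        = pi * ((\<Sum>j<N. P N j * P N (j + n)) - (\<Sum>j<N. P N j * P N (j + Suc n)))"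
      unfolding integral_unique[OF int] sgn by (simp add: algebra_simps)
    moreover have "P N 0 * (P N n - P N (Suc n))
        \<le> (\<Sum>j<N. P N j * P N (j + n)) - (\<Sum>j<N. P N j * P N (j + Suc n))"
    proof (rule truncated_antitone_correlation_lower_bound)
      show "0 \<le> P N k" for k
        using q central_coeff_pos[of k] by (simp add: P_def)
      show "P N (Suc k) \<le> P N k" for k
        using q central_coeff_pos[of k] central_coeff_pos[of "Suc k"] central_coeff_Suc_less[of k]
        by (auto simp: P_def intro!: mult_mono mult_left_le_one_le)
    qed (use that in auto)
    ultimately show ?thesis by (simp add: mult_left_mono)
  qed
  have "(\<lambda>N. integral {-(pi/2)..pi/2} (\<lambda>u. T N u * F u))
      \<longlonglongrightarrow> integral {-(pi/2)..pi/2} (\<lambda>u. F u / c u)"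
  proof (rule dominated_convergence(2))
    show "(\<lambda>u. T N u * F u) integrable_on {-(pi/2)..pi/2}" for N
      using int by (rule has_integral_integrable)
    show "(\<lambda>u. (1 / (1 - q))\<^sup>2 * 2) integrable_on {-(pi/2)..pi/2}"
      by (rule integrable_const_ivl)
    show "norm (T N u * F u) \<le> (1 / (1 - q))\<^sup>2 * 2" for N u
    proof -
      have "\<bar>F u\<bar> \<le> 2"
        unfolding F_def using abs_cos_le_one[of "2 * real n * u"] abs_cos_le_one[of "2 * real (Suc n) * u"]
        by linarith
      thus ?thesis using T_bound[of N u] unfolding real_norm_def abs_mult
        by (intro mult_mono) (auto simp: T_def)
    qed
    show "(\<lambda>N. T N u * F u) \<longlonglongrightarrow> F u / c u" for u
      using tendsto_mult[OF T_lim tendsto_const, of u "F u"] by simp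
  qed
  hence lim: "(\<lambda>N. (-1) ^ n * integral {-(pi/2)..pi/2} (\<lambda>u. T N u * F u))
      \<longlonglongrightarrow> (-1) ^ n * integral {-(pi/2)..pi/2} (\<lambda>u. F u / c u)"
    by (intro tendsto_intros)
  have "\<forall>\<^sub>F N in sequentially. pi * (central_coeff n * q ^ n * (1 - q + q / (2 * real n + 2)))
      \<le> (-1) ^ n * integral {-(pi/2)..pi/2} (\<lambda>u. T N u * F u)"
    using eventually_ge_at_top[of "n + 2"]
  proof eventually_elim
    case (elim N)
    have "P N 0 * (P N n - P N (Suc n)) = central_coeff n * q ^ n * (1 - q + q / (2 * real n + 2))"
      using elim by (simp add: P_def central_coeff_Suc field_simps)
    with int_ge[of N] elim show ?case by simp
  qed
  from tendsto_lowerbound[OF lim this] show ?thesis by (simp add: F_def)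
qed

section \<open>The distance of a half-integer exponential from integer exponentials\<close>

lemma has_integral_odd_real:
  fixes f :: "real \<Rightarrow> real"
  assumes cont: "continuous_on {-a..a} f" and odd: "\<And>x. f (- x) = - f x"
  shows "(f has_integral 0) {-a..a}"
proof -
  have int: "(f has_integral integral {-a..a} f) {-a..a}"
    using integrable_integral[OF integrable_continuous_real[OF cont]] .
  hence "((\<lambda>x. f (- x)) has_integral integral {-a..a} f) {-a..a}"
    using has_integral_reflect_real[of f _ a "- a"] by simp
  hence "((\<lambda>x. - f x) has_integral integral {-a..a} f) {-a..a}"
    by (simp add: odd)
  moreover have "((\<lambda>x. - f x) has_integral - integral {-a..a} f) {-a..a}"
    using int by (rule has_integral_neg)
  ultimately have "integral {-a..a} f = - integral {-a..a} f"
    by (rule has_integral_unique)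
  with int show ?thesis by simp
qed

text \<open>
  The substitution \<open>\<xi> = 2 * half_arc s u\<close> maps \<open>{-pi/2..pi/2}\<close> onto the interval \<open>{-\<delta>'..\<delta>'}\<close> when
  \<open>s = sin (\<delta>'/2)\<close>; then \<open>sin (\<xi>/2)\<close> is proportional to \<open>sin u\<close>.
\<close>
definition half_arc :: "real \<Rightarrow> real \<Rightarrow> real" where
  "half_arc s u = arcsin (s * sin u)"

text \<open>
  This is the derivative of \<open>2 * half_arc s\<close>, see \<open>half_arc_has_derivative\<close>.
\<close>
definition arc_weight :: "real \<Rightarrow> real \<Rightarrow> real" where
  "arc_weight s u = 2 * s * cos u / cos (half_arc s u)"

context
  fixes s :: real
  assumes s: "0 < s" "s < 1"
begin

lemma abs_scaled_sin_less_1: "\<bar>s * sin u\<bar> < 1"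
proof -
  have "s * \<bar>sin u\<bar> \<le> s * 1"
    using s by (intro mult_left_mono) auto
  moreover have "\<bar>s * sin u\<bar> = s * \<bar>sin u\<bar>"
    using s by (simp add: abs_mult)
  ultimately show ?thesis using s by linarith
qed

lemma sin_half_arc: "sin (half_arc s u) = s * sin u"
  using abs_scaled_sin_less_1[of u] by (auto simp: half_arc_def abs_less_iff intro!: sin_arcsin)

lemma cos_half_arc: "cos (half_arc s u) = sqrt (1 - (s * sin u)\<^sup>2)"
  using abs_scaled_sin_less_1[of u] by (auto simp: half_arc_def abs_less_iff intro!: cos_arcsin)

lemma cos_half_arc_pos: "0 < cos (half_arc s u)"
  using abs_scaled_sin_less_1[of u] by (simp add: cos_half_arc abs_square_less_1)

lemma cos_double_half_arc: "cos (2 * half_arc s u) = 1 - s\<^sup>2 + s\<^sup>2 * cos (2 * u)"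
  unfolding cos_double_sin sin_half_arc power_mult_distrib by (simp add: algebra_simps)

lemma half_arc_minus: "half_arc s (- u) = - half_arc s u"
  using abs_scaled_sin_less_1[of u] by (auto simp: half_arc_def abs_less_iff intro!: arcsin_minus)

lemma arc_weight_minus: "arc_weight s (- u) = arc_weight s u"
  by (simp add: arc_weight_def half_arc_minus)

lemma half_arc_has_derivative:
  "(half_arc s has_field_derivative (arc_weight s u / 2)) (at u within A)"
proof -
  have "((\<lambda>u. arcsin (s * sin u)) has_field_derivative
      (s * cos u * inverse (sqrt (1 - (s * sin u)\<^sup>2)))) (at u within A)"
    using abs_scaled_sin_less_1[of u]
    by (auto intro!: derivative_eq_intros simp: abs_less_iff)
  thus ?thesis
    unfolding half_arc_def[abs_def] arc_weight_def cos_half_arc[unfolded half_arc_def]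
    by (simp add: field_simps half_arc_def[symmetric] cos_half_arc)
qed

lemma continuous_on_half_arc [continuous_intros]: "continuous_on A (half_arc s)"
  by (rule DERIV_continuous_on) (rule half_arc_has_derivative)

lemma continuous_on_arc_weight [continuous_intros]: "continuous_on A (arc_weight s)"
  unfolding arc_weight_def[abs_def]
  using cos_half_arc_pos by (intro continuous_intros) (auto simp: less_imp_neq[symmetric])

text \<open>
  The upper bound rests on \<open>s\<^sup>2 * (cos u)\<^sup>2 = s\<^sup>2 - (s * sin u)\<^sup>2 \<le> 1 - (s * sin u)\<^sup>2\<close>, where the last term is
  the squared cosine of \<open>half_arc s u\<close>.
\<close>
lemma arc_weight_bounds:
  assumes "u \<in> {-(pi/2)..pi/2}"
  shows "0 \<le> arc_weight s u" "arc_weight s u \<le> 2"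
proof -
  have c: "0 \<le> cos u" using assms by (intro cos_ge_zero) auto
  thus "0 \<le> arc_weight s u"
    using s cos_half_arc_pos[of u] by (simp add: arc_weight_def)
  have "(s * cos u)\<^sup>2 = s\<^sup>2 - (s * sin u)\<^sup>2"
    by (simp add: power_mult_distrib cos_squared_eq algebra_simps)
  also have "\<dots> \<le> 1 - (sin (half_arc s u))\<^sup>2"
    using s by (simp add: sin_half_arc power_le_one)
  also have "\<dots> = (cos (half_arc s u))\<^sup>2"
    by (simp add: cos_squared_eq)
  finally have "(s * cos u)\<^sup>2 \<le> (cos (half_arc s u))\<^sup>2" .
  hence "s * cos u \<le> cos (half_arc s u)"
    using cos_half_arc_pos[of u] by (simp add: power2_le_iff_abs_le)
  thus "arc_weight s u \<le> 2"
    using cos_half_arc_pos[of u] by (simp add: arc_weight_def field_simps)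
qed

lemma cos_add_cos_diff: "cos (x + z) + cos (x - z) = 2 * cos z * cos (x::real)"
  by (simp add: cos_add cos_diff)

text \<open>
  With \<open>\<alpha> = half_arc s u\<close>, the factor \<open>cos ((2 * k + 1) * \<alpha>) * arc_weight s u\<close> is a combination of
  \<open>cos ((2 * i + 1) * u)\<close>, \<open>i \<le> k\<close>. Instead of these combinations the proof carries their orthogonality
  to all higher frequencies \<open>m\<close> through the recursion
  \<open>cos ((2 * k + 3) * \<alpha>) = 2 * cos (2 * \<alpha>) * cos ((2 * k + 1) * \<alpha>) - cos ((2 * k - 1) * \<alpha>)\<close>, in which
  \<open>cos (2 * \<alpha>)\<close> is an affine function of \<open>cos (2 * u)\<close> and therefore shifts \<open>m\<close> by at most one.
\<close>
lemma has_integral_cos_odd_half_arc: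
  fixes k m :: nat
  assumes "k < m"
  shows "((\<lambda>u. cos (real (2 * m + 1) * u) * (cos (real (2 * k + 1) * half_arc s u) * arc_weight s u))
      has_integral 0) {-(pi/2)..pi/2}"
proof -
  define f where "f m k u = cos (real (2 * m + 1) * u) * (cos (real (2 * k + 1) * half_arc s u) * arc_weight s u)"
    for m k u
  have base: "(f m 0 has_integral 0) {-(pi/2)..pi/2}" if "0 < m" for m
  proof -
    have "f m 0 = (\<lambda>u. s * (cos (2 * of_int (int m) * u) + cos (2 * of_int (int m + 1) * u)))"
    proof
      fix u
      have "f m 0 u = 2 * s * (cos (real (2 * m + 1) * u) * cos u)"
        using cos_half_arc_pos[of u] by (simp add: f_def arc_weight_def)
      also have "\<dots> = s * (cos (2 * of_int (int m) * u) + cos (2 * of_int (int m + 1) * u))"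
        by (simp add: cos_times_cos algebra_simps)
      finally show "f m 0 u = s * (cos (2 * of_int (int m) * u) + cos (2 * of_int (int m + 1) * u))" .
    qed
    moreover have "((\<lambda>u. s * (cos (2 * of_int (int m) * u) + cos (2 * of_int (int m + 1) * u)))
        has_integral s * ((if int m = 0 then pi else 0) + (if int m + 1 = 0 then pi else 0))) {-(pi/2)..pi/2}"
      by (intro has_integral_mult_right has_integral_add has_integral_cos_even)
    ultimately show ?thesis using that by simp
  qed
  \<comment> \<open>Truncated subtraction is intended: for \<open>k = 0\<close> the recursion refers to the index \<open>-1\<close>,
    and \<open>cos (- \<alpha>) = cos \<alpha>\<close> is the term of index \<open>0\<close>.\<close>
  have "(\<forall>m>k. (f m k has_integral 0) {-(pi/2)..pi/2})
      \<and> (\<forall>m>k. (f m (k - 1) has_integral 0) {-(pi/2)..pi/2})"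
  proof (induction k)
    case 0
    show ?case using base by simp
  next
    case (Suc k)
    have "(f m (Suc k) has_integral 0) {-(pi/2)..pi/2}" if m: "Suc k < m" for m
    proof -
      have rec: "f m (Suc k) u = 2 * (1 - s\<^sup>2) * f m k u + s\<^sup>2 * (f (m + 1) k u + f (m - 1) k u)
          - f m (k - 1) u" for u
      proof -
        define a where "a = half_arc s u"
        have "cos (real (2 * Suc k + 1) * a) + cos (real (2 * (k - 1) + 1) * a)
            = 2 * cos (2 * a) * cos (real (2 * k + 1) * a)"
        proof (cases k)
          case 0
          thus ?thesis using cos_add_cos_diff[of a "2 * a"] by simp
        next
          case (Suc l)
          thus ?thesis using cos_add_cos_diff[of "real (2 * k + 1) * a" "2 * a"]
            by (simp add: algebra_simps)
        qed
        hence 1: "cos (real (2 * Suc k + 1) * a)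
            = 2 * cos (2 * a) * cos (real (2 * k + 1) * a) - cos (real (2 * (k - 1) + 1) * a)"
          by simp
        have 2: "cos (real (2 * (m + 1) + 1) * u) + cos (real (2 * (m - 1) + 1) * u)
            = 2 * cos (2 * u) * cos (real (2 * m + 1) * u)"
          using m cos_add_cos_diff[of "real (2 * m + 1) * u" "2 * u"]
          by (cases m) (simp_all add: algebra_simps)
        have "f (m + 1) k u + f (m - 1) k u
            = (cos (real (2 * (m + 1) + 1) * u) + cos (real (2 * (m - 1) + 1) * u))
                * (cos (real (2 * k + 1) * a) * arc_weight s u)"
          by (simp add: f_def a_def ring_distribs)
        hence 3: "f (m + 1) k u + f (m - 1) k u = 2 * cos (2 * u) * f m k u"
          unfolding 2 by (simp add: f_def a_def)
        have "f m (Suc k) u = 2 * cos (2 * a) * f m k u - f m (k - 1) u"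
          unfolding f_def a_def[symmetric] 1 by (simp only: ring_distribs mult_ac)
        thus ?thesis
          unfolding 3 a_def cos_double_half_arc by (simp add: algebra_simps)
      qed
      have "((\<lambda>u. 2 * (1 - s\<^sup>2) * f m k u + s\<^sup>2 * (f (m + 1) k u + f (m - 1) k u) - f m (k - 1) u)
        has_integral (2 * (1 - s\<^sup>2) * 0 + s\<^sup>2 * (0 + 0) - 0)) {-(pi/2)..pi/2}"
        using Suc m by (intro has_integral_diff has_integral_add has_integral_mult_right) auto
      thus ?thesis unfolding rec[abs_def] by simp
    qed
    moreover have "(f m (Suc k - 1) has_integral 0) {-(pi/2)..pi/2}" if "Suc k < m" for m
      using Suc that by simp
    ultimately show ?case by blast
  qed
  thus ?thesis using assms by (simp add: f_def[abs_def])
qed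

text \<open>
  The frequencies \<open>k - 1/2\<close> with \<open>-n < k \<le> n\<close> are, up to sign, the numbers \<open>i + 1/2\<close> with \<open>i < n\<close>. Their
  cosines are covered by \<open>has_integral_cos_odd_half_arc\<close>, and their sines are odd in \<open>u\<close>.
\<close>
lemma has_integral_exponential_orthogonal:
  assumes k: "k \<in> sample_points n"
  shows "((\<lambda>u. cos (real (2 * n + 1) * u) * (Re (c * cis ((of_int k - 1/2) * (2 * half_arc s u)))
      * arc_weight s u)) has_integral 0) {-(pi/2)..pi/2}"
proof -
  define x where "x = 2 * of_int k - (1::real)"
  obtain i :: nat where i: "i < n" "x = real (2 * i + 1) \<or> x = - real (2 * i + 1)"
  proof (cases "1 \<le> k")
    case True
    with k that[of "nat (k - 1)"] show ?thesis by (auto simp: x_def sample_points_def)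
  next
    case False
    with k that[of "nat (- k)"] show ?thesis by (auto simp: x_def sample_points_def)
  qed
  have "cos (x * a) = cos (real (2 * i + 1) * a)" for a
  proof (cases "x = real (2 * i + 1)")
    case False
    with i have "x = - real (2 * i + 1)" by simp
    hence "x * a = - (real (2 * i + 1) * a)" by (simp only: minus_mult_left)
    thus ?thesis by (simp only: cos_minus)
  qed simp
  hence "((\<lambda>u. cos (real (2 * n + 1) * u) * (cos (x * half_arc s u) * arc_weight s u))
      has_integral 0) {-(pi/2)..pi/2}"
    using has_integral_cos_odd_half_arc[OF i(1)] by simp
  moreover have "((\<lambda>u. cos (real (2 * n + 1) * u) * (sin (x * half_arc s u) * arc_weight s u))
      has_integral 0) {-(pi/2)..pi/2}"
    by (intro has_integral_odd_real continuous_intros)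
       (simp_all add: half_arc_minus arc_weight_minus)
  ultimately have "((\<lambda>u. Re c * (cos (real (2 * n + 1) * u) * (cos (x * half_arc s u) * arc_weight s u))
       - Im c * (cos (real (2 * n + 1) * u) * (sin (x * half_arc s u) * arc_weight s u)))
      has_integral Re c * 0 - Im c * 0) {-(pi/2)..pi/2}"
    by (intro has_integral_diff has_integral_mult_right)
  thus ?thesis
    by (simp add: x_def algebra_simps)
qed

end

text \<open>
  Duality: \<open>h u = cos ((2 * n + 1) * u)\<close> annihilates the exponentials, so the real part of the error function \<open>G\<close>
  has the same integral \<open>I\<close> against \<open>h\<close> as the constant \<open>1\<close>. The integral of \<open>(h u)\<^sup>2\<close> against the weight is at
  most \<open>pi\<close>, and the Cauchy-Schwarz inequality bounds the squared norm of \<open>G\<close> below by \<open>I\<^sup>2 / pi\<close>.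
\<close>
lemma trigonometric_approximation_lower_bound:
  fixes y :: real and c :: "int \<Rightarrow> complex"
  assumes y: "0 < y" "y < pi / 4" and n: "1 \<le> n"
  defines "T \<equiv> tan y"
  shows "(2 * sqrt pi * (T ^ (2 * n + 1) * central_coeff n * (1 - T\<^sup>2 + T\<^sup>2 / (2 * real n + 2))))\<^sup>2
    \<le> integral {-(4 * y)..4 * y}
        (\<lambda>\<xi>. (norm (1 - (\<Sum>k\<in>sample_points n. c k * cis ((of_int k - 1/2) * \<xi>))))\<^sup>2)"
proof -
  define s where "s = sin (2 * y)"
  define G where "G \<xi> = 1 - (\<Sum>k\<in>sample_points n. c k * cis ((of_int k - 1/2) * \<xi>))" for \<xi>
  define h where "h u = cos (real (2 * n + 1) * u)" for u
  define w where "w = arc_weight s"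
  define \<phi> where "\<phi> u = 2 * half_arc s u" for u
  define I where "I = integral {-(pi/2)..pi/2} (\<lambda>u. h u * w u)"
  have s: "0 < s" "s < 1"
    using y sin_gt_zero[of "2 * y"] sin_monotone_2pi[of "2 * y" "pi / 2"] by (auto simp: s_def)
  have cosy: "0 < cos y" using y by (intro cos_gt_zero) auto
  have T: "0 < T" "T < 1"
    using y tan_gt_zero[of y] tan_monotone[of y "pi/4"] by (auto simp: T_def tan_45)
  have contG: "continuous_on A G" for A
    unfolding G_def[abs_def] cis_conv_exp by (intro continuous_intros)
  have cont\<phi>: "continuous_on A \<phi>" and contw: "continuous_on A w" and conth: "continuous_on A h" for A
    unfolding \<phi>_def[abs_def] w_def h_def[abs_def] using s by (auto intro!: continuous_intros)
  have contG\<phi>: "continuous_on A (\<lambda>u. Re (G (\<phi> u)))" for A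
    by (intro continuous_intros continuous_on_compose2[OF contG[of UNIV] cont\<phi>]) auto
  have \<phi>_end: "\<phi> (pi/2) = 4 * y" "\<phi> (-(pi/2)) = -(4 * y)"
    using y s by (simp_all add: \<phi>_def half_arc_minus) (simp_all add: half_arc_def s_def arcsin_sin)
  have subst: "((\<lambda>u. w u *\<^sub>R (norm (G (\<phi> u)))\<^sup>2) has_integral
      integral {\<phi> (-(pi/2))..\<phi> (pi/2)} (\<lambda>\<xi>. (norm (G \<xi>))\<^sup>2)) {-(pi/2)..pi/2}"
  proof (rule has_integral_substitution)
    \<comment> \<open>Any interval containing \<open>{-pi..pi}\<close> would do here.\<close>
    show "\<phi> ` {-(pi/2)..pi/2} \<subseteq> {-4..4}"
    proof safe
      fix u :: real
      have "\<bar>half_arc s u\<bar> \<le> pi / 2"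
        using abs_scaled_sin_less_1[OF s, of u] arcsin_bounded[of "s * sin u"]
        by (auto simp: half_arc_def abs_le_iff abs_less_iff)
      thus "\<phi> u \<in> {-4..4}" using pi_less_4 by (auto simp: \<phi>_def abs_le_iff)
    qed
    show "continuous_on {-4..4} (\<lambda>\<xi>. (norm (G \<xi>))\<^sup>2)"
      by (intro continuous_intros contG)
    show "(\<phi> has_real_derivative w x) (at x within {-(pi/2)..pi/2})" for x
      unfolding \<phi>_def[abs_def] w_def
      using half_arc_has_derivative[OF s] by (auto intro!: derivative_eq_intros)
  qed (use y \<phi>_end in auto)
  have hRw: "((\<lambda>u. h u * (Re (G (\<phi> u)) * w u)) has_integral I) {-(pi/2)..pi/2}"
  proof -
    have "((\<lambda>u. h u * w u) has_integral I) {-(pi/2)..pi/2}"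
      unfolding I_def by (intro integrable_integral integrable_continuous_real continuous_intros conth contw)
    hence "((\<lambda>u. h u * w u - (\<Sum>k\<in>sample_points n. h u * (Re (c k * cis ((of_int k - 1/2) * \<phi> u)) * w u)))
        has_integral I - (\<Sum>k\<in>sample_points n. 0)) {-(pi/2)..pi/2}"
      unfolding h_def \<phi>_def w_def
      by (intro has_integral_diff has_integral_sum has_integral_exponential_orthogonal[OF s])
         (auto simp: sample_points_def)
    thus ?thesis
      by (simp add: G_def left_diff_distrib right_diff_distrib sum_distrib_left sum_distrib_right
          sum_subtractf mult_ac)
  qed
  have hhw: "integral {-(pi/2)..pi/2} (\<lambda>u. (h u)\<^sup>2 * w u) \<le> pi"
  proof -
    have "((\<lambda>u. 1 + cos (2 * of_int (2 * int n + 1) * u)) has_integral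
       pi + (if 2 * int n + 1 = 0 then pi else 0)) {-(pi/2)..pi/2}"
      using has_integral_const_real[of "1::real" "-(pi/2)" "pi/2"]
      by (intro has_integral_add has_integral_cos_even) simp
    moreover have "1 + cos (2 * of_int (2 * int n + 1) * u) = (h u)\<^sup>2 * 2" for u
      using cos_double_cos[of "real (2 * n + 1) * u"] by (simp add: h_def algebra_simps)
    ultimately have "((\<lambda>u. (h u)\<^sup>2 * 2) has_integral pi) {-(pi/2)..pi/2}" by simp
    moreover have "((\<lambda>u. (h u)\<^sup>2 * w u) has_integral integral {-(pi/2)..pi/2} (\<lambda>u. (h u)\<^sup>2 * w u)) {-(pi/2)..pi/2}"
      by (intro integrable_integral integrable_continuous_real continuous_intros conth contw)
    ultimately show ?thesis
      using arc_weight_bounds(2)[OF s] by (rule_tac has_integral_le) (auto intro!: mult_left_mono simp: w_def)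
  qed
  have "I\<^sup>2 / pi \<le> integral {-(4 * y)..4 * y} (\<lambda>\<xi>. (norm (G \<xi>))\<^sup>2)"
  proof -
    \<comment> \<open>Cauchy-Schwarz as a tangent-line bound: integrate \<open>(Re G - l * h)\<^sup>2 \<ge> 0\<close>; this \<open>l\<close> is the optimal choice.\<close>
    define l where "l = I / pi"
    let ?L = "\<lambda>u. 2 * l * (h u * (Re (G (\<phi> u)) * w u)) - l\<^sup>2 * ((h u)\<^sup>2 * w u)"
    have "(?L has_integral 2 * l * I - l\<^sup>2 * integral {-(pi/2)..pi/2} (\<lambda>u. (h u)\<^sup>2 * w u)) {-(pi/2)..pi/2}"
      by (intro has_integral_diff has_integral_mult_right hRw integrable_integral
          integrable_continuous_real continuous_intros conth contw)
    moreover have "?L u \<le> w u *\<^sub>R (norm (G (\<phi> u)))\<^sup>2" if "u \<in> {-(pi/2)..pi/2}" for u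
    proof -
      have "2 * l * h u * Re (G (\<phi> u)) - l\<^sup>2 * (h u)\<^sup>2 \<le> (Re (G (\<phi> u)))\<^sup>2"
        using zero_le_power2[of "Re (G (\<phi> u)) - l * h u"] by (simp add: power2_eq_square algebra_simps)
      also have "\<dots> \<le> (norm (G (\<phi> u)))\<^sup>2"
        by (simp add: cmod_power2)
      finally have "w u * (2 * l * h u * Re (G (\<phi> u)) - l\<^sup>2 * (h u)\<^sup>2) \<le> w u * (norm (G (\<phi> u)))\<^sup>2"
        using arc_weight_bounds(1)[OF s that] by (intro mult_left_mono) (simp_all add: w_def)
      thus ?thesis by (simp add: algebra_simps)
    qed
    ultimately have "2 * l * I - l\<^sup>2 * integral {-(pi/2)..pi/2} (\<lambda>u. (h u)\<^sup>2 * w u)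
        \<le> integral {\<phi> (-(pi/2))..\<phi> (pi/2)} (\<lambda>\<xi>. (norm (G \<xi>))\<^sup>2)"
      by (rule has_integral_le[OF _ subst])
    moreover have "l\<^sup>2 * integral {-(pi/2)..pi/2} (\<lambda>u. (h u)\<^sup>2 * w u) \<le> l\<^sup>2 * pi"
      by (intro mult_left_mono hhw) auto
    moreover have "2 * l * I - l\<^sup>2 * pi = I\<^sup>2 / pi"
      by (simp add: l_def power2_eq_square field_simps)
    ultimately show ?thesis unfolding \<phi>_end by linarith
  qed
  moreover have "2 * T * (pi * (central_coeff n * T ^ (2 * n) * (1 - T\<^sup>2 + T\<^sup>2 / (2 * real n + 2))))
      \<le> (-1) ^ n * I"
  proof -
    have w_eq: "h u * w u = 2 * T * ((cos (2 * real n * u) + cos (2 * real (Suc n) * u))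
        / norm (1 + of_real (T\<^sup>2) * cis (2 * u)))" for u
    proof -
      \<comment> \<open>Half-angle parametrisation: \<open>1 - s\<^sup>2 * (sin u)\<^sup>2\<close> is a multiple of a squared chord length.\<close>
      have "(cos y)\<^sup>2 * norm (1 + of_real (T\<^sup>2) * cis (2 * u)) = cos (half_arc s u)"
      proof (rule power2_eq_imp_eq)
        have sy: "sin y = T * cos y" using cosy by (simp add: T_def tan_def)
        have one: "(cos y)\<^sup>2 * (1 + T\<^sup>2) = 1"
          using sin_cos_squared_add[of y] by (simp add: sy power_mult_distrib algebra_simps)
        have "((cos y)\<^sup>2 * norm (1 + of_real (T\<^sup>2) * cis (2 * u)))\<^sup>2
            = ((cos y)\<^sup>2)\<^sup>2 * ((1 + T\<^sup>2 * cos (2 * u))\<^sup>2 + (T\<^sup>2 * sin (2 * u))\<^sup>2)"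
          by (simp add: power_mult_distrib cmod_power2)
        also have "(1 + T\<^sup>2 * cos (2 * u))\<^sup>2 + (T\<^sup>2 * sin (2 * u))\<^sup>2
            = 1 + 2 * T\<^sup>2 * cos (2 * u) + (T\<^sup>2)\<^sup>2 * ((sin (2 * u))\<^sup>2 + (cos (2 * u))\<^sup>2)"
          by algebra
        also have "\<dots> = (1 + T\<^sup>2)\<^sup>2 - 4 * T\<^sup>2 * (sin u)\<^sup>2"
          using sin_cos_squared_add[of "2 * u"] cos_double_sin[of u] by algebra
        also have "((cos y)\<^sup>2)\<^sup>2 * \<dots> = ((cos y)\<^sup>2 * (1 + T\<^sup>2))\<^sup>2 - (2 * (T * cos y) * cos y * sin u)\<^sup>2"
          by (simp add: power2_eq_square algebra_simps)
        also have "\<dots> = 1 - (s * sin u)\<^sup>2"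
          unfolding one sy[symmetric] s_def sin_double by simp
        also have "\<dots> = (cos (half_arc s u))\<^sup>2"
          by (simp add: cos_squared_eq sin_half_arc[OF s])
        finally show "((cos y)\<^sup>2 * norm (1 + of_real (T\<^sup>2) * cis (2 * u)))\<^sup>2 = (cos (half_arc s u))\<^sup>2" .
      qed (use cos_half_arc_pos[OF s, of u] in auto)
      hence "w u = 2 * s * cos u / ((cos y)\<^sup>2 * norm (1 + of_real (T\<^sup>2) * cis (2 * u)))"
        by (simp add: w_def arc_weight_def)
      moreover have "s = 2 * T * (cos y)\<^sup>2"
        using cosy by (simp add: s_def sin_double T_def tan_def power2_eq_square)
      ultimately have "w u = 2 * (2 * T) * cos u / norm (1 + of_real (T\<^sup>2) * cis (2 * u))"
        using cosy by simp
      moreover have "2 * (h u * cos u) = cos (2 * real n * u) + cos (2 * real (Suc n) * u)"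
        by (simp add: h_def cos_times_cos algebra_simps)
      moreover have "h u * (2 * (2 * T) * cos u / N) = 2 * T * ((2 * (h u * cos u)) / N)" for N
        by simp
      ultimately show ?thesis by simp
    qed
    have "pi * (central_coeff n * (T\<^sup>2) ^ n * (1 - T\<^sup>2 + T\<^sup>2 / (2 * real n + 2)))
      \<le> (-1) ^ n * integral {-(pi/2)..pi/2} (\<lambda>u. (cos (2 * real n * u) + cos (2 * real (Suc n) * u))
          / norm (1 + of_real (T\<^sup>2) * cis (2 * u)))" (is "_ \<le> _ * ?J")
      using T n by (intro inverse_norm_fourier_lower_bound) (auto simp: power_less_one_iff)
    moreover have IJ: "I = 2 * T * ?J"
      unfolding I_def w_eq by (rule integral_mult_right)
    ultimately have "2 * T * (pi * (central_coeff n * (T\<^sup>2) ^ n * (1 - T\<^sup>2 + T\<^sup>2 / (2 * real n + 2))))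
        \<le> 2 * T * ((-1) ^ n * ?J)"
      using T by (intro mult_left_mono) auto
    also have "\<dots> = (-1) ^ n * I"
      unfolding IJ by (simp only: mult_ac)
    finally show ?thesis by (simp only: power_mult)
  qed
  hence "(2 * T * (pi * (central_coeff n * T ^ (2 * n) * (1 - T\<^sup>2 + T\<^sup>2 / (2 * real n + 2)))))\<^sup>2
      \<le> ((-1) ^ n * I)\<^sup>2"
    using T central_coeff_pos[of n] by (intro power_mono) (auto simp: power_le_one_iff intro!: mult_nonneg_nonneg add_nonneg_nonneg)
  hence "(2 * T * (pi * (central_coeff n * T ^ (2 * n) * (1 - T\<^sup>2 + T\<^sup>2 / (2 * real n + 2)))))\<^sup>2 / pi
      \<le> I\<^sup>2 / pi"
    by (intro divide_right_mono) (auto simp: power_mult_distrib simp flip: power_mult)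
  moreover have "(2 * T * (pi * (central_coeff n * T ^ (2 * n) * (1 - T\<^sup>2 + T\<^sup>2 / (2 * real n + 2)))))\<^sup>2 / pi
     = (2 * sqrt pi * (T ^ (2 * n + 1) * central_coeff n * (1 - T\<^sup>2 + T\<^sup>2 / (2 * real n + 2))))\<^sup>2"
    by (simp add: power_mult_distrib) (simp add: power2_eq_square)
  ultimately show ?thesis by (simp add: G_def)
qed

lemma tan_ge_cubic:
  assumes "0 \<le> y" "y < pi / 2"
  shows "y + y ^ 3 / 3 \<le> tan y"
proof -
  have "tan 0 - (0 + 0 ^ 3 / 3) \<le> tan y - (y + y ^ 3 / 3)"
  proof (rule DERIV_nonneg_imp_increasing_open[where f = "\<lambda>x. tan x - (x + x ^ 3 / 3)"])
    fix x assume x: "0 < x" "x < y"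
    hence c: "cos x \<noteq> 0" using assms cos_gt_zero[of x] by auto
    have sec: "inverse ((cos x)\<^sup>2) = 1 + (tan x)\<^sup>2"
      using tan_sec[OF c] by (simp add: power_inverse)
    have "((\<lambda>x. tan x - (x + x ^ 3 / 3)) has_real_derivative (1 + (tan x)\<^sup>2 - (1 + x\<^sup>2))) (at x)"
      using c by (auto intro!: derivative_eq_intros simp: sec)
    moreover have "x \<le> tan x"
      using x assms abs_tan_ge[of x] tan_gt_zero[of x] by auto
    hence "x\<^sup>2 \<le> (tan x)\<^sup>2" using x by (intro power_mono) auto
    ultimately show "\<exists>d. ((\<lambda>x. tan x - (x + x ^ 3 / 3)) has_real_derivative d) (at x) \<and> 0 \<le> d"
      by (intro exI[of _ "1 + (tan x)\<^sup>2 - (1 + x\<^sup>2)"]) auto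
  next
    have "cos x \<noteq> 0" if "x \<in> {0..y}" for x
      using that assms cos_gt_zero_pi[of x] by force
    thus "continuous_on {0..y} (\<lambda>x. tan x - (x + x ^ 3 / 3))"
      by (intro continuous_intros) auto
  qed (use assms in auto)
  thus ?thesis by simp
qed

text \<open>
  The constant is about \<open>0.137\<close>; the value \<open>1/6\<close> leaves room for crude estimates on both sides.
\<close>
lemma constant_bound: "5 * sqrt 2 / (11 * exp 1 * sqrt 3) \<le> (1/6::real)"
proof -
  have e: "5/2 \<le> exp (1::real)"
    using exp_lower_Taylor_quadratic[of "1::real"] by simp
  have "sqrt 2 \<le> (3/2::real)"
    by (rule real_le_lsqrt) (auto simp: power2_eq_square)
  moreover have "17/10 \<le> sqrt (3::real)"
    by (rule real_le_rsqrt) (auto simp: power2_eq_square)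
  ultimately have "30 * sqrt 2 \<le> 11 * (5/2) * (17/10::real)" by simp
  also have "\<dots> \<le> 11 * exp 1 * sqrt (3::real)"
    using e \<open>17/10 \<le> sqrt (3::real)\<close> by (intro mult_mono) auto
  finally show ?thesis by (simp add: field_simps)
qed

text \<open>
  The factor \<open>D = 1 - T\<^sup>2 + T\<^sup>2 / (2 * n + 2)\<close> is at least \<open>1/2\<close> when \<open>y \<le> 1/2\<close>. For larger \<open>y\<close> it may be
  as small as \<open>1 / (2 * n + 2)\<close>, but then \<open>(T / y) ^ (2 * n + 1) \<ge> (1 + y\<^sup>2 / 3) ^ (2 * n + 1)\<close> grows at
  least like \<open>1 + n / 6\<close> and compensates for it together with the loss \<open>1 / sqrt n\<close> from
  \<open>central_coeff n\<close>.
\<close>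
lemma trigonometric_bound_ge_power_bound:
  fixes y :: real
  assumes y: "0 < y" "y < pi / 4" and n: "1 \<le> n"
  defines "T \<equiv> tan y"
  shows "4 * y / (2 * real n + 1) * y ^ (2 * n) / 6
    \<le> 2 * sqrt pi * (T ^ (2 * n + 1) * central_coeff n * (1 - T\<^sup>2 + T\<^sup>2 / (2 * real n + 2)))"
proof -
  have ypi: "y < pi / 2" using y by simp
  have T: "0 < T" "T < 1"
    using y tan_gt_zero[of y] tan_monotone[of y "pi/4"] by (auto simp: T_def tan_45)
  have Ty: "y * (1 + y\<^sup>2 / 3) \<le> T"
    using tan_ge_cubic[of y] y ypi by (simp add: T_def power2_eq_square power3_eq_cube algebra_simps)
  define r where "r = sqrt (real n)"
  have r: "1 \<le> r" "real n = r\<^sup>2" using n by (auto simp: r_def)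
  define D where "D = 1 - T\<^sup>2 + T\<^sup>2 / (2 * real n + 2)"
  have T2: "0 \<le> T\<^sup>2" "T\<^sup>2 \<le> 1" using T by (auto simp: power_le_one)
  \<comment> \<open>The factor \<open>2 * r\<close> anticipates \<open>central_coeff n \<ge> 1 / (2 * r)\<close>.\<close>
  have key: "y ^ (2 * n + 1) * (2 * r / (3 * (2 * real n + 1))) \<le> T ^ (2 * n + 1) * D"
  proof (cases "y \<le> 1/2")
    case True
    have cosy: "7/8 \<le> cos y"
    proof -
      have "(sin (y / 2))\<^sup>2 \<le> (1/4)\<^sup>2"
        using y True sin_x_le_x[of "y / 2"] sin_gt_zero[of "y / 2"] by (intro power_mono) auto
      thus ?thesis using cos_double_sin[of "y / 2"] by (simp add: power2_eq_square)
    qed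
    have "sin y \<le> 1/2" using sin_x_le_x[of y] y True by simp
    hence "T \<le> (1/2) / (7/8)"
      using cosy y sin_gt_zero[of y] unfolding T_def tan_def by (intro frac_le) auto
    hence "T\<^sup>2 \<le> (4/7)\<^sup>2" using T by (intro power_mono) auto
    hence D: "1/2 \<le> D"
      unfolding D_def using T2 by (simp add: power2_eq_square add_increasing2)
    have "2 * r / (3 * (2 * real n + 1)) \<le> 1/2"
    proof -
      have "4 * r \<le> 3 * (2 * r\<^sup>2 + 1)"
        using zero_le_power2[of "r - 1"] r(1) by (simp add: power2_eq_square algebra_simps)
      moreover have "0 < 3 * (2 * r\<^sup>2 + 1)" by (simp add: add_nonneg_pos)
      ultimately show ?thesis unfolding r(2) by (subst pos_divide_le_eq) auto
    qed
    with D have "2 * r / (3 * (2 * real n + 1)) \<le> D" by (rule order_trans[rotated])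
    moreover have "y ^ (2 * n + 1) \<le> T ^ (2 * n + 1)"
      using y tan_ge_cubic[of y] ypi by (intro power_mono) (auto simp: T_def add_increasing2 intro: order_trans[rotated])
    ultimately show ?thesis
      using y T r by (intro mult_mono) auto
  next
    case False
    have "1 + 1/12 \<le> 1 + y\<^sup>2 / 3"
      using False power_mono[of "1/2" y 2] by (simp add: power2_eq_square)
    hence "1 / 12 \<le> y\<^sup>2 / 3" by simp
    hence "1 + real n / 6 \<le> 1 + real (2 * n + 1) * (y\<^sup>2 / 3)"
      using mult_mono[of "real (2 * n)" "real (2 * n + 1)" "1/12" "y\<^sup>2 / 3"] by simp
    also have "\<dots> \<le> (1 + y\<^sup>2 / 3) ^ (2 * n + 1)"
      by (rule Bernoulli_inequality) (simp add: add_increasing2 order_trans[of _ 0])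
    finally have B: "1 + real n / 6 \<le> (1 + y\<^sup>2 / 3) ^ (2 * n + 1)" .
    have "y ^ (2 * n + 1) * (1 + real n / 6) \<le> y ^ (2 * n + 1) * (1 + y\<^sup>2 / 3) ^ (2 * n + 1)"
      using y B by (intro mult_left_mono) auto
    also have "\<dots> \<le> T ^ (2 * n + 1)"
      unfolding power_mult_distrib[symmetric] using Ty y by (intro power_mono) auto
    finally have P: "y ^ (2 * n + 1) * (1 + real n / 6) \<le> T ^ (2 * n + 1)" .
    have "1 / (2 * real n + 2) \<le> D"
    proof -
      have "T\<^sup>2 * (1 - 1 / (2 * real n + 2)) \<le> 1 * (1 - 1 / (2 * real n + 2))"
        using T2 by (intro mult_right_mono) auto
      thus ?thesis by (simp add: D_def algebra_simps)
    qed
    hence "(1 + real n / 6) * (1 / (2 * real n + 2)) \<le> (1 + real n / 6) * D"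
      by (intro mult_left_mono) auto
    moreover have "2 * r / (3 * (2 * real n + 1)) \<le> (1 + real n / 6) * (1 / (2 * real n + 2))"
    proof -
      \<comment> \<open>The difference of the two sides is this sum of squares plus \<open>7/5\<close>.\<close>
      have "0 \<le> (r\<^sup>2 - 2 * r)\<^sup>2 + 5/2 * (r - 4/5)\<^sup>2" by simp
      hence ineq: "2 * r * (2 * r\<^sup>2 + 2) \<le> (1 + r\<^sup>2 / 6) * (3 * (2 * r\<^sup>2 + 1))"
        by (simp add: power2_eq_square algebra_simps)
      have p: "0 < 2 * r\<^sup>2 + 2" "0 < 3 * (2 * r\<^sup>2 + 1)" by (simp_all add: add_nonneg_pos)
      show ?thesis
        unfolding r(2) pos_divide_le_eq[OF p(2)] times_divide_eq_right times_divide_eq_left mult_1_right pos_le_divide_eq[OF p(1)]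
        by (rule ineq)
    qed
    ultimately have "y ^ (2 * n + 1) * (2 * r / (3 * (2 * real n + 1)))
        \<le> y ^ (2 * n + 1) * ((1 + real n / 6) * D)"
      using y by (intro mult_left_mono) auto
    also have "\<dots> = y ^ (2 * n + 1) * (1 + real n / 6) * D" by simp
    also have "\<dots> \<le> T ^ (2 * n + 1) * D"
      using P T2 by (intro mult_right_mono) (auto simp: D_def)
    finally show ?thesis .
  qed
  have sqrtpi: "1 \<le> sqrt pi" using pi_gt3 by simp
  have "4 * y / (2 * real n + 1) * y ^ (2 * n) / 6
      = 2 * 1 * (y ^ (2 * n + 1) * (2 * r / (3 * (2 * real n + 1))) * (1 / (2 * r)))"
    using r(1) by (simp add: field_simps)
  also have "\<dots> \<le> 2 * sqrt pi * (T ^ (2 * n + 1) * D * central_coeff n)"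
  proof (rule mult_mono)
    show "y ^ (2 * n + 1) * (2 * r / (3 * (2 * real n + 1))) * (1 / (2 * r))
        \<le> T ^ (2 * n + 1) * D * central_coeff n"
      using central_coeff_lower_bound[OF n] T T2 r(1)
      by (intro mult_mono[OF key]) (auto simp: r_def D_def)
  qed (use sqrtpi y r in auto)
  finally show ?thesis by (simp add: D_def mult_ac)
qed

text \<open>
  Translating \<open>{a..b}\<close> to a symmetric interval multiplies the coefficients by numbers of modulus
  one. Factoring out \<open>cis (\<xi>/2)\<close>, which has modulus one itself, shifts all frequencies by \<open>1/2\<close>.
\<close>
lemma exponential_approximation_lower_bound:
  fixes c :: "int \<Rightarrow> complex"
  assumes ab: "a < b" "b - a < 2 * pi" and n: "1 \<le> n"
  defines "\<delta>' \<equiv> (b - a) / 2"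
  shows "(\<delta>' / (2 * real n + 1) * (\<delta>' / 4) ^ (2 * n) / 6)\<^sup>2
    \<le> integral {a..b} (\<lambda>\<xi>. (norm (cis (1/2 * \<xi>) - (\<Sum>j\<in>sample_points n. c j * cis (of_int j * \<xi>))))\<^sup>2)"
proof -
  define P where "P \<xi> = cis (1/2 * \<xi>) - (\<Sum>j\<in>sample_points n. c j * cis (of_int j * \<xi>))" for \<xi>
  define y where "y = \<delta>' / 4"
  define mid where "mid = (a + b) / 2"
  define c' where "c' j = c j * cis ((of_int j - 1/2) * mid)" for j :: int
  have y: "0 < y" "y < pi / 4" "4 * y = \<delta>'" using ab by (auto simp: y_def \<delta>'_def)
  have ends: "-(4 * y) + mid = a" "4 * y + mid = b"
    by (simp_all add: y_def \<delta>'_def mid_def field_simps)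
  have norm_P: "norm (P (x + mid)) = norm (1 - (\<Sum>k\<in>sample_points n. c' k * cis ((of_int k - 1/2) * x)))" for x
  proof -
    have "cis (of_int j * (x + mid))
        = cis (1/2 * (x + mid)) * (cis ((of_int j - 1/2) * mid) * cis ((of_int j - 1/2) * x))" for j :: int
      unfolding cis_mult by (rule arg_cong[where f = cis]) (simp add: field_simps)
    hence "P (x + mid) = cis (1/2 * (x + mid)) * (1 - (\<Sum>k\<in>sample_points n. c' k * cis ((of_int k - 1/2) * x)))"
      unfolding P_def right_diff_distrib sum_distrib_left
      by (simp add: c'_def mult_ac)
    thus ?thesis by (simp add: norm_mult)
  qed
  have contP: "continuous_on A (\<lambda>\<xi>. (norm (P \<xi>))\<^sup>2)" for A
    unfolding P_def cis_conv_exp by (intro continuous_intros)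
  have "(\<delta>' / (2 * real n + 1) * (\<delta>' / 4) ^ (2 * n) / 6)\<^sup>2
      \<le> (2 * sqrt pi * ((tan y) ^ (2 * n + 1) * central_coeff n * (1 - (tan y)\<^sup>2 + (tan y)\<^sup>2 / (2 * real n + 2))))\<^sup>2"
    using trigonometric_bound_ge_power_bound[OF y(1,2) n] y(1) unfolding y(3)
    by (intro power_mono) (simp_all add: y_def)
  also have "\<dots> \<le> integral {-(4 * y)..4 * y}
      (\<lambda>x. (norm (1 - (\<Sum>k\<in>sample_points n. c' k * cis ((of_int k - 1/2) * x))))\<^sup>2)"
    by (rule trigonometric_approximation_lower_bound[OF y(1,2) n])
  also have "\<dots> = integral {-(4 * y)..4 * y} ((\<lambda>\<xi>. (norm (P \<xi>))\<^sup>2) \<circ> (\<lambda>x. x + mid))"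
    by (simp add: norm_P o_def)
  also have "\<dots> = integral {a..b} (\<lambda>\<xi>. (norm (P \<xi>))\<^sup>2)"
    using integral_shift[OF contP, of "-(4 * y)" "4 * y" mid] unfolding ends by simp
  finally show ?thesis by (simp add: P_def)
qed

section \<open>The lower bound for the reconstruction error\<close>

theorem theorem2p10:
  fixes M :: "'w measure"
    and X :: "real \<Rightarrow> 'w \<Rightarrow> complex"
    and \<rho> :: "real \<Rightarrow> real"
    and \<delta> a b m :: real
    and n :: nat
  assumes "0 < \<delta>" and "\<delta> < pi"
    and "wide_sense_stationary M X"
    and "(\<lambda>t. autocorrelation M X t 0) \<in> paley_wiener \<delta>"
    and "square_integrable_on {-\<delta>..\<delta>} \<rho>"
    and "AE \<xi> in lebesgue_on {-\<delta>..\<delta>}. 0 \<le> \<rho> \<xi>"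
    and "\<And>t \<tau>. autocorrelation M X t \<tau> =
           (LINT \<xi>|lebesgue_on {-\<delta>..\<delta>}.
              exp (\<i> * complex_of_real ((t - \<tau>) * \<xi>)) * complex_of_real (\<rho> \<xi>))"
    and "a < b" and "{a..b} \<subseteq> {-\<delta>..\<delta>}"
    and "0 < m" and "AE \<xi> in lebesgue_on {a..b}. m \<le> \<rho> \<xi>"
    and "1 \<le> n"
  shows "let \<delta>' = (b - a) / 2 in
     min_reconstruction_error n (autocorrelation M X) \<ge>
       ereal (5 * sqrt (2 * m) / (11 * exp 1 * sqrt 3) *
              (\<delta>' / (2 * real n + 1)) * (\<delta>' / 4) ^ (2 * n))"
proof -
  define K where "K = autocorrelation M X"
  define \<delta>' where "\<delta>' = (b - a) / 2"
  have K: "K = spectral_kernel \<delta> \<rho>"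
    unfolding K_def by (intro ext) (simp add: assms(7) spectral_kernel_def cis_conv_exp)
  interpret spectral_density \<delta> \<rho>
  proof
    show "integrable (lebesgue_on {-\<delta>..\<delta>}) \<rho>"
    proof (rule Bochner_Integration.integrable_bound)
      show "integrable (lebesgue_on {-\<delta>..\<delta>}) (\<lambda>\<xi>. 1 + (norm (\<rho> \<xi>))\<^sup>2)"
      proof (rule Bochner_Integration.integrable_add)
        show "integrable (lebesgue_on {-\<delta>..\<delta>}) (\<lambda>\<xi>. 1::real)"
          by (intro continuous_imp_integrable_real continuous_on_const)
      qed (use assms(5) in \<open>simp add: square_integrable_on_def\<close>)
      show "\<rho> \<in> borel_measurable (lebesgue_on {-\<delta>..\<delta>})"
        using assms(5) by (simp add: square_integrable_on_def)
      have "norm r \<le> norm (1 + (norm r)\<^sup>2)" for r :: real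
        using zero_le_power2[of "\<bar>r\<bar> - 1"] by (simp add: power2_eq_square algebra_simps)
      thus "AE \<xi> in lebesgue_on {-\<delta>..\<delta>}. norm (\<rho> \<xi>) \<le> norm (1 + (norm (\<rho> \<xi>))\<^sup>2)" by simp
    qed
  qed (rule assms(6))
  interpret R: reproducing_kernel_hilbert_space "fst (rkhs K)" "snd (rkhs K)" K
    unfolding K by (rule rkhs_is_reproducing)
  have fin: "finite (sample_points n)" by (simp add: sample_points_def)
  obtain c f where f: "f = (\<lambda>x. K (1/2) x - (\<Sum>j\<in>sample_points n. c j * K (of_int j) x))"
      "f \<in> fst (rkhs K)" "\<forall>j\<in>sample_points n. f (of_int j) = 0"
      "snd (rkhs K) f f = f (1/2)"
    by (rule R.kernel_residual_exists[OF fin, where t = "1/2" and p = real_of_int])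
  define P where "P \<xi> = cis (1/2 * \<xi>) - (\<Sum>j\<in>sample_points n. c j * cis (of_int j * \<xi>))" for \<xi>
  define r where "r = Re (f (1/2))"
  have r_eq: "has_bochner_integral \<mu> (\<lambda>\<xi>. (norm (P \<xi>))\<^sup>2 * \<rho> \<xi>) r" "f (1/2) = of_real r"
    unfolding P_def r_def
    using kernel_residual_value[OF f(1)[unfolded K]] f(3) by (auto simp: complex_eq_iff)
  define L where "L = \<delta>' / (2 * real n + 1) * (\<delta>' / 4) ^ (2 * n)"
  have L: "0 < L" using assms(8) by (simp add: L_def \<delta>'_def)
  have mL: "m * (L / 6)\<^sup>2 \<le> r"
  proof -
    have "b - a < 2 * pi" using assms(1,2,8,9) by auto
    hence "(L / 6)\<^sup>2 \<le> integral {a..b} (\<lambda>\<xi>. (norm (P \<xi>))\<^sup>2)"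
      unfolding L_def P_def \<delta>'_def
      using exponential_approximation_lower_bound[OF assms(8) _ assms(12)] by simp
    hence "m * (L / 6)\<^sup>2 \<le> m * integral {a..b} (\<lambda>\<xi>. (norm (P \<xi>))\<^sup>2)"
      using assms(10) by (intro mult_left_mono) auto
    also have "\<dots> \<le> r"
      using r_eq(1) assms(9,11) unfolding P_def cis_conv_exp
      by (intro weighted_integral_ge continuous_intros)
    finally show ?thesis .
  qed
  have r: "0 < r" using mL L assms(10) by (smt (verit) divide_pos_pos mult_pos_pos zero_less_power)
  \<comment> \<open>The sign \<open>e\<close> treats \<open>f\<close> and \<open>- f\<close> at once.\<close>
  have in_ball: "(\<lambda>x. of_real e / of_real (sqrt r) * f x) \<in> rkhs_unit_ball K" if "e\<^sup>2 = 1" for e :: real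
  proof -
    let ?s = "complex_of_real e / of_real (sqrt r)"
    have "snd (rkhs K) (\<lambda>x. ?s * f x) (\<lambda>x. ?s * f x) = ?s * snd (rkhs K) f (\<lambda>x. ?s * f x)"
      using f(2) by (intro R.ip_scale R.scale_mem)
    also have "snd (rkhs K) f (\<lambda>x. ?s * f x) = cnj (?s * f (1/2))"
      using R.ip_cnj[OF R.scale_mem[OF f(2)] f(2), of ?s] R.ip_scale[OF f(2) f(2), of ?s]
      by (simp add: f(4))
    also have "?s * cnj (?s * f (1/2)) = of_real (e\<^sup>2 * r / (sqrt r * sqrt r))"
      by (simp add: r_eq(2) power2_eq_square del: real_sqrt_mult_self)
    also have "\<dots> = 1" using that r by simp
    finally show ?thesis
      using R.scale_mem[OF f(2), of ?s] by (simp add: rkhs_unit_ball_def rkhs_norm_def)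
  qed
  define g where "g x = f x / of_real (sqrt r)" for x
  have g_ball: "g \<in> rkhs_unit_ball K" "(\<lambda>x. - g x) \<in> rkhs_unit_ball K"
    using in_ball[of 1] in_ball[of "-1"] by (simp_all add: g_def[abs_def])
  have contK: "continuous_on UNIV (K s)" for s
  proof -
    have "continuous_on UNIV (\<lambda>t. K t 0)" using assms(4) by (simp add: paley_wiener_def K_def)
    hence "continuous_on UNIV (\<lambda>x. K (s - x) 0)"
      by (rule continuous_on_compose2) (auto intro!: continuous_intros)
    moreover have "K (s - x) 0 = K s x" for x by (simp add: K spectral_kernel_def)
    ultimately show ?thesis by simp
  qed
  have contg: "continuous_on UNIV g"
    unfolding g_def[abs_def] f(1) using r by (intro continuous_intros contK) auto
  have "ereal (norm (g (1/2))) \<le> min_reconstruction_error n K"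
    using f(3) by (intro min_reconstruction_error_ge[OF g_ball contg]) (auto simp: g_def)
  moreover have "5 * sqrt (2 * m) / (11 * exp 1 * sqrt 3) * L \<le> norm (g (1/2))"
  proof -
    have "norm (g (1/2)) = r / sqrt r"
      using r by (simp add: g_def r_eq(2) norm_divide)
    also have "\<dots> = sqrt r" by (simp add: real_div_sqrt r less_imp_le)
    finally have g_norm: "norm (g (1/2)) = sqrt r" .
    have "5 * sqrt (2 * m) / (11 * exp 1 * sqrt 3) * L
        = sqrt m * ((5 * sqrt 2 / (11 * exp 1 * sqrt 3)) * L)"
      by (simp add: real_sqrt_mult)
    also have "\<dots> \<le> sqrt m * ((1/6) * L)"
      using assms(10) L constant_bound by (intro mult_left_mono mult_right_mono) auto
    also have "\<dots> = sqrt (m * (L / 6)\<^sup>2)"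
      using L by (simp add: real_sqrt_mult)
    also have "\<dots> \<le> sqrt r" using mL by simp
    finally show ?thesis unfolding g_norm .
  qed
  ultimately have "ereal (5 * sqrt (2 * m) / (11 * exp 1 * sqrt 3) * L) \<le> min_reconstruction_error n K"
    by (metis ereal_less_eq(3) order_trans)
  thus ?thesis
    unfolding Let_def L_def \<delta>'_def K_def by (simp only: mult.assoc)
qed

end
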